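(* Let $n\ge 3$, and let $Z$ be an $(n-1)$-cycle (with integral coefficients, in the simplicial chain complex of a finite-dimensional abstract simplex $\Delta^M$). For each edge $\{u,v\}$ of $\operatorname{supp}(Z)$ let $\ell_{uv}$ be a formal variable, and let $\mathbb{Z}[\ell]$ be the polynomial ring over $\mathbb{Z}$ in these variables. Then there exist an integer $N\ge1$ and polynomials $b_1,\ldots,b_N\in\mathbb{Z}[\ell]$ such that for every polyhedron $P\colon|\operatorname{supp}(Z)|\to\mathbb{R}^n$ of combinatorial type $Z$, with $W=2^{[\frac n2]}\,n!\,V_Z(P)$, $$W^{2N}+b_1(\ell)W^{2N-2}+\dots+b_N(\ell)=0,$$ where the polynomials $b_i$ are evaluated at the squares of the edge lengths of $P$, i.e. at $\ell_{uv}=\|P(u)-P(v)\|^2$ for edges $\{u,v\}$ of $\operatorname{supp}(Z)$.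
   Context: $\Delta^M$ is an abstract simplex of (large) dimension $M$; $C_k(\Delta^M)$ is the free Abelian group generated by oriented $k$-faces of $\Delta^M$ (reversing orientation changes sign), $\partial\colon C_k\to C_{k-1}$ the simplicial boundary operator. A chain $Z\in C_k(\Delta^M)$ is a cycle if $\partial Z=0$. The support $\operatorname{supp}(Z)$ is the subcomplex of $\Delta^M$ consisting of all $k$-simplices entering $Z$ with non-zero coefficients and all their faces; $|\operatorname{supp}(Z)|$ is its geometric realization. A simplicial polyhedron of combinatorial type $Z$ (an $(n-1)$-cycle) is a map $P\colon|\operatorname{supp}(Z)|\to\mathbb{R}^n$ whose restriction to every simplex is linear (affine); it need not be injective and may be degenerate. The generalized oriented volume is $$V_Z(P)=\sum_{i=1}^q c_i\,V\bigl(O,P(v_1^{(i)}),\ldots,P(v_n^{(i)})\bigr),\qquad Z=\sum_{i=1}^q c_i\{v_1^{(i)},\ldots,v_n^{(i)}\},\ c_i\in\mathbb{Z},$$ where $\{v_1,\ldots,v_n\}$ denotes the simplex oriented by the ordering of its vertices, $O\in\mathbb{R}^n$ is an arbitrary point (the result does not depend on it), and $V(p_0,\ldots,p_n)=\frac1{n!}\det(p_1-p_0,\ldots,p_n-p_0)$. $[\cdot]$ denotes integer part. *)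

theory Defs
  imports "HOL-Library.Poly_Mapping" "Jordan_Normal_Form.Determinant"
begin

section \<open>Simplicial chains of the simplex with vertex set \<open>{..M}\<close>\<close>

text \<open>
  The free Abelian group generated by oriented \<open>k\<close>-faces, in which reversing the orientation
  changes the sign, has the \<open>k\<close>-faces as a basis once one of the two orientations of each face
  has been chosen. Throughout, a finite vertex set \<open>s\<close> stands for the simplex oriented by the
  increasing order of its vertices; the opposite orientation is \<open>- frag_of s\<close>.
\<close>

definition chains :: "nat \<Rightarrow> nat \<Rightarrow> (nat set \<Rightarrow>\<^sub>0 int) set" where
  "chains M k = {Z. \<forall>s \<in> Poly_Mapping.keys Z. s \<subseteq> {..M} \<and> card s = k + 1}"

definition simplex_boundary :: "nat set \<Rightarrow> (nat set \<Rightarrow>\<^sub>0 int)" where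
  "simplex_boundary s =
     (if card s \<le> 1 then 0
      else \<Sum>i<card s. frag_cmul ((-1) ^ i) (frag_of (s - {sorted_list_of_set s ! i})))"

definition chain_boundary :: "(nat set \<Rightarrow>\<^sub>0 int) \<Rightarrow> (nat set \<Rightarrow>\<^sub>0 int)" where
  "chain_boundary = frag_extend simplex_boundary"

definition cycles :: "nat \<Rightarrow> nat \<Rightarrow> (nat set \<Rightarrow>\<^sub>0 int) set" where
  "cycles M k = {Z \<in> chains M k. chain_boundary Z = 0}"

text \<open>The empty simplex is not counted as a member of a complex.\<close>

definition supp :: "(nat set \<Rightarrow>\<^sub>0 int) \<Rightarrow> nat set set" where
  "supp Z = {t. t \<noteq> {} \<and> (\<exists>s \<in> Poly_Mapping.keys Z. t \<subseteq> s)}"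

definition edges :: "nat set set \<Rightarrow> nat set set" where
  "edges K = {e \<in> K. card e = 2}"

section \<open>Polyhedra\<close>

text \<open>Points of a geometric realization are given by their barycentric coordinates.\<close>

definition realization :: "nat set set \<Rightarrow> (nat \<Rightarrow> real) set" where
  "realization K = {x. (\<forall>v. 0 \<le> x v) \<and> {v. x v \<noteq> 0} \<in> K \<and> (\<Sum>v \<in> {v. x v \<noteq> 0}. x v) = 1}"

definition closed_simplex :: "nat set \<Rightarrow> (nat \<Rightarrow> real) set" where
  "closed_simplex s = realization {t. t \<noteq> {} \<and> t \<subseteq> s}"

definition vertex_point :: "nat \<Rightarrow> (nat \<Rightarrow> real)" where
  "vertex_point v = (\<lambda>w. if w = v then 1 else 0)"

definition polyhedron :: "nat \<Rightarrow> (nat set \<Rightarrow>\<^sub>0 int) \<Rightarrow> ((nat \<Rightarrow> real) \<Rightarrow> real vec) \<Rightarrow> bool" where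
  "polyhedron n Z P \<longleftrightarrow>
     (\<forall>x \<in> realization (supp Z). P x \<in> carrier_vec n) \<and>
     (\<forall>s \<in> supp Z. \<forall>x \<in> closed_simplex s. \<forall>y \<in> closed_simplex s. \<forall>t. 0 \<le> t \<and> t \<le> 1 \<longrightarrow>
        P (\<lambda>v. (1 - t) * x v + t * y v) = (1 - t) \<cdot>\<^sub>v P x + t \<cdot>\<^sub>v P y)"

definition euclidean_norm :: "real vec \<Rightarrow> real" where
  "euclidean_norm x = sqrt (x \<bullet> x)"

text \<open>An edge \<open>e = {u, v}\<close> has endpoints \<open>Min e\<close> and \<open>Max e\<close>.\<close>

definition edge_length_sq :: "((nat \<Rightarrow> real) \<Rightarrow> real vec) \<Rightarrow> nat set \<Rightarrow> real" where
  "edge_length_sq P e =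
     (euclidean_norm (P (vertex_point (Min e)) - P (vertex_point (Max e))))\<^sup>2"

section \<open>Generalized oriented volume\<close>

definition simplex_volume :: "nat \<Rightarrow> real vec \<Rightarrow> real vec list \<Rightarrow> real" where
  "simplex_volume n p0 ps = det (mat_of_cols n (map (\<lambda>p. p - p0) ps)) / fact n"

text \<open>
  The coefficient of \<open>s\<close> refers to the increasing orientation, so the image points are
  taken in that order.
\<close>

definition gen_volume ::
    "nat \<Rightarrow> (nat set \<Rightarrow>\<^sub>0 int) \<Rightarrow> real vec \<Rightarrow> ((nat \<Rightarrow> real) \<Rightarrow> real vec) \<Rightarrow> real" where
  "gen_volume n Z q P =
     (\<Sum>s \<in> Poly_Mapping.keys Z. of_int (Poly_Mapping.lookup Z s) *
        simplex_volume n q (map (\<lambda>v. P (vertex_point v)) (sorted_list_of_set s)))"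

section \<open>Integral polynomials in several variables\<close>

text \<open>
  A monomial is a finitely supported exponent function. With the convolution product of
  \<open>Poly_Mapping\<close>, finitely supported integer functions on monomials form the polynomial ring
  over the integers; \<open>int_polys E\<close> is its subring of polynomials in the variables from \<open>E\<close>.
\<close>

type_synonym 'v int_mpoly = "('v \<Rightarrow>\<^sub>0 nat) \<Rightarrow>\<^sub>0 int"

definition int_polys :: "'v set \<Rightarrow> 'v int_mpoly set" where
  "int_polys E = {p. \<forall>m \<in> Poly_Mapping.keys p. Poly_Mapping.keys m \<subseteq> E}"

definition eval_mpoly :: "('v \<Rightarrow> real) \<Rightarrow> 'v int_mpoly \<Rightarrow> real" where
  "eval_mpoly x p =
     (\<Sum>m \<in> Poly_Mapping.keys p. of_int (Poly_Mapping.lookup p m) *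
        (\<Prod>e \<in> Poly_Mapping.keys m. x e ^ Poly_Mapping.lookup m e))"

end

theory Submission
  imports Defs "HOL-Computational_Algebra.Polynomial" "HOL-Library.Nat_Bijection"
begin

text \<open>
  Treat the coordinates of the vertices as independent variables over the integers and let \<open>F\<close> be
  the field of fractions of their polynomial ring. Both the scaled volume \<open>W\<close> and the squared edge
  lengths live in \<open>F\<close>, and the claim says that \<open>W\<^sup>2\<close> is integral over the ring \<open>B\<close> generated by the
  squared edge lengths: a monic equation in \<open>F\<close> is an identity of integer polynomials in the
  coordinates, so it specialises to every polyhedron. An element of a field is integral over a
  subring as soon as it lies in every valuation ring containing that subring
  (\<open>integral_if_in_valuation_rings\<close>), so fix a valuation ring \<open>R\<close> of \<open>F\<close> with \<open>B \<subseteq> R\<close>; it has to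
  be shown that \<open>W \<in> R\<close>.

  Call two vertices near if their squared distance lies in \<open>R\<close>, and far otherwise. The cycle \<open>Z\<close> is
  made of cliques of the near graph. Suppose that \<open>Z\<close> is the boundary of a chain \<open>Y\<close> of such cliques.
  Then \<open>W\<close> is an integer combination of the numbers \<open>2\<close> to the \<open>[n/2]\<close> times \<open>n!\<close> times the volume of
  an \<open>n\<close>-simplex with all edges near. The square of such a number is, up to the power of \<open>2\<close>, a Gram
  determinant with entries in \<open>R\<close>, and for odd \<open>n\<close> the spare factor \<open>2\<close> can be split off because a
  symmetric matrix of odd size with even diagonal has even determinant
  (\<open>simplex_volume_integral\<close>). Valuation rings are integrally closed, so \<open>W \<in> R\<close>.

  It remains to see that \<open>Z\<close> bounds. The clique complex of the complete graph is a simplex, in which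
  all cycles bound. The near graph is reached from it by deleting the far pairs one after the other,
  the largest squared distance (in the sense of the valuation) first. Deleting the edge \<open>{u, v}\<close>
  preserves the filling of a cycle if the link of that edge has a filling in one dimension less.
  Unwinding this recursion, an unfillable cycle of \<open>k\<close>-element cliques with \<open>k > d\<close> produces \<open>d + 1\<close>
  disjoint far pairs such that distances between different pairs are dominated by the distances
  inside the pairs (\<open>cycle_bounds_if_no_obstruction\<close>, \<open>obstruction_pairs\<close>). For \<open>r\<close> such pairs the
  matrix of squared distances of the \<open>2 * r\<close> vertices is nonsingular
  (\<open>dominated_kernel_trivial\<close>), while squared distances in dimension \<open>n\<close> form a matrix of rank at
  most \<open>n + 2\<close>. Thus \<open>r \<le> [n/2] + 1\<close> (\<open>obstruction_length\<close>), and cycles of \<open>k\<close>-element cliques bound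
  for \<open>k > [n/2] + 1\<close>. The simplices of \<open>Z\<close> have \<open>n\<close> vertices, and \<open>n > [n/2] + 1\<close> holds exactly
  when \<open>n \<ge> 3\<close>.
\<close>

section \<open>Integrality and valuation rings\<close>

definition subring :: "'a::comm_ring_1 set \<Rightarrow> bool" where
  "subring R \<longleftrightarrow> 1 \<in> R \<and> (\<forall>x\<in>R. \<forall>y\<in>R. x - y \<in> R \<and> x * y \<in> R)"

lemma subringD:
  assumes "subring R"
  shows "0 \<in> R" "1 \<in> R" "x \<in> R \<Longrightarrow> y \<in> R \<Longrightarrow> x * y \<in> R" "x \<in> R \<Longrightarrow> y \<in> R \<Longrightarrow> x - y \<in> R"
    "x \<in> R \<Longrightarrow> - x \<in> R" "x \<in> R \<Longrightarrow> y \<in> R \<Longrightarrow> x + y \<in> R"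
proof -
  show 0: "0 \<in> R" using assms unfolding subring_def by (metis diff_self)
  show m: "- x \<in> R" if "x \<in> R" for x using assms that 0 unfolding subring_def by (metis diff_0)
  show "x \<in> R \<Longrightarrow> y \<in> R \<Longrightarrow> x + y \<in> R"
    using assms m unfolding subring_def by (metis diff_minus_eq_add)
qed (use assms in \<open>auto simp: subring_def\<close>)

lemma subring_sum: "subring R \<Longrightarrow> (\<And>i. i \<in> A \<Longrightarrow> f i \<in> R) \<Longrightarrow> sum f A \<in> R"
  by (induction A rule: infinite_finite_induct) (auto simp: subringD)

lemma subring_prod: "subring R \<Longrightarrow> (\<And>i. i \<in> A \<Longrightarrow> f i \<in> R) \<Longrightarrow> prod f A \<in> R"
  by (induction A rule: infinite_finite_induct) (auto simp: subringD)

lemma subring_power: "subring R \<Longrightarrow> x \<in> R \<Longrightarrow> x ^ k \<in> R"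
  by (induction k) (auto simp: subringD)

lemma subring_of_int: "subring R \<Longrightarrow> of_int k \<in> R"
proof -
  assume R: "subring R"
  have "of_nat j \<in> R" for j by (induction j) (auto simp: subringD[OF R])
  then show ?thesis by (cases k) (auto simp: subringD[OF R] simp del: of_nat_Suc)
qed

definition adjoin :: "'a::comm_ring_1 set \<Rightarrow> 'a \<Rightarrow> 'a set" where
  "adjoin R x = {poly p x | p. \<forall>i. coeff p i \<in> R}"

lemma subring_adjoin:
  assumes R: "subring R"
  shows "subring (adjoin R x)" "R \<subseteq> adjoin R x" "x \<in> adjoin R x"
proof -
  show "subring (adjoin R x)"
    unfolding subring_def
  proof (intro conjI ballI)
    show "1 \<in> adjoin R x"
      unfolding adjoin_def using subringD(1,2)[OF R]
      by (auto intro!: exI[of _ "[:1:]"] simp: coeff_pCons split: nat.split)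
  next
    fix a b assume "a \<in> adjoin R x" "b \<in> adjoin R x"
    then obtain p q where pq: "a = poly p x" "b = poly q x" "\<forall>i. coeff p i \<in> R" "\<forall>i. coeff q i \<in> R"
      unfolding adjoin_def by auto
    show "a - b \<in> adjoin R x" unfolding adjoin_def
      using pq by (auto intro!: exI[of _ "p - q"] simp: subringD[OF R])
    show "a * b \<in> adjoin R x" unfolding adjoin_def
      using pq by (auto intro!: exI[of _ "p * q"] subring_sum[OF R] simp: subringD[OF R] coeff_mult)
  qed
  show "R \<subseteq> adjoin R x"
  proof
    fix a assume "a \<in> R"
    then have "\<forall>i. coeff [:a:] i \<in> R" using subringD(1)[OF R] by (simp add: coeff_pCons split: nat.split)
    then show "a \<in> adjoin R x" unfolding adjoin_def by (auto intro!: exI[of _ "[:a:]"])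
  qed
  have "\<forall>i. coeff [:0, 1:] i \<in> R" using subringD(1,2)[OF R] by (simp add: coeff_pCons split: nat.split)
  then show "x \<in> adjoin R x" unfolding adjoin_def by (auto intro!: exI[of _ "[:0,1:]"])
qed

locale valuation_ring =
  fixes R :: "'a::field set"
  assumes subring: "subring R"
    and total: "x \<in> R \<or> inverse x \<in> R"

text \<open>
  The heart of the existence of valuation rings. Of two expressions of \<open>1\<close>, one as \<open>t\<close> times a
  polynomial in \<open>x\<close> and one as \<open>t\<close> times a polynomial in \<open>1 / x\<close>, the one of larger degree can be
  shortened: since \<open>1 - t * b\<close> is a unit, the other expression can be solved for its constant term
  and then rewrites the top power of \<open>x\<close> by lower ones.
\<close>

lemma no_dual_relations:
  fixes R :: "'a::field set"
  assumes R: "subring R" and t: "t \<in> R"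
    and units: "\<And>b. b \<in> R \<Longrightarrow> 1 - t * b \<noteq> 0 \<and> inverse (1 - t * b) \<in> R"
    and x: "x \<noteq> 0" and p: "\<forall>i. coeff p i \<in> R" "1 = t * poly p x"
    and q: "\<forall>i. coeff q i \<in> R" "1 = t * poly q (inverse x)"
  shows False
  using x p q
proof (induction "degree p + degree q" arbitrary: p q x rule: less_induct)
  case less
  note Rs = subringD[OF R]
  have *: False
    if le: "degree q \<le> degree p" and x: "x \<noteq> 0" and p: "\<forall>i. coeff p i \<in> R" "1 = t * poly p x"
      and q: "\<forall>i. coeff q i \<in> R" "1 = t * poly q (inverse x)"
      and IH: "\<And>p'. degree p' < degree p \<Longrightarrow> \<forall>i. coeff p' i \<in> R \<Longrightarrow> 1 = t * poly p' x \<Longrightarrow> False"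
    for p q x
  proof -
    obtain b q' where qc: "q = pCons b q'" by (cases q)
    have bR: "b \<in> R" and q'R: "\<And>i. coeff q' i \<in> R"
      using q(1) qc by (metis coeff_pCons_0, metis coeff_pCons_Suc)
    define s where "s = inverse (1 - t * b)"
    have sR: "s \<in> R" and nz: "1 - t * b \<noteq> 0" using units[OF bR] by (auto simp: s_def)
    have q'0: "q' \<noteq> 0"
      using q(2) nz qc by auto
    define n m where "n = degree p" and "m = degree q'"
    have mn: "m < n" using le q'0 qc by (simp add: n_def m_def)
    have rel: "1 = t * s * inverse x * poly q' (inverse x)"
    proof -
      have "1 - t * b = t * inverse x * poly q' (inverse x)"
        using q(2) qc by (simp add: algebra_simps)
      then have "s * (1 - t * b) = s * (t * inverse x * poly q' (inverse x))" by simp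
      moreover have "s * (1 - t * b) = 1" unfolding s_def using nz by (rule left_inverse)
      ultimately have "1 = s * (t * inverse x * poly q' (inverse x))" by metis
      then show ?thesis by (simp add: mult_ac)
    qed
    \<comment> \<open>the relation \<open>rel\<close>, multiplied by \<open>x ^ n\<close>, eliminates the leading term \<open>a * x ^ n\<close>\<close>
    define a where "a = coeff p n"
    define r where "r = reflect_poly q'"
    have xn: "x ^ n = t * s * x ^ (n - Suc m) * poly r x"
    proof -
      have "x ^ n = x ^ (n - Suc m) * x ^ m * x"
        using mn by (simp flip: power_add power_Suc2)
      also have "\<dots> = x ^ (n - Suc m) * x ^ m * x * (t * s * inverse x * poly q' (inverse x))"
        using rel by simp
      also have "\<dots> = t * s * x ^ (n - Suc m) * (x ^ m * poly q' (inverse x))"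
        using x by simp
      also have "x ^ m * poly q' (inverse x) = poly r x"
        using x by (simp add: r_def m_def poly_reflect_poly_nz)
      finally show ?thesis .
    qed
    define p' where "p' = (p - monom a n) + monom (a * t * s) (n - Suc m) * r"
    have rR: "coeff r i \<in> R" for i using q'R Rs by (auto simp: r_def coeff_reflect_poly)
    have aR: "a \<in> R" using p by (simp add: a_def)
    have "\<forall>i. coeff p' i \<in> R"
      using p aR rR sR t by (auto simp: p'_def coeff_monom_mult Rs intro!: Rs)
    moreover have "1 = t * poly p' x"
    proof -
      have "poly p' x = poly p x - a * x ^ n + a * (t * s * x ^ (n - Suc m) * poly r x)"
        by (simp add: p'_def poly_monom algebra_simps)
      also have "\<dots> = poly p x" using xn by simp
      finally show ?thesis using p by simp
    qed
    moreover have "degree p' < degree p"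
    proof -
      have "degree (p - monom a n) < n"
      proof -
        have "degree (p - monom a n) \<le> n"
          by (rule degree_diff_le) (auto simp: n_def degree_monom_le)
        moreover have "coeff (p - monom a n) n = 0" by (simp add: a_def)
        ultimately show ?thesis
          using mn by (metis degree_0 eq_zero_or_degree_less gr_zeroI less_nat_zero_code le_neq_implies_less leading_coeff_0_iff)
      qed
      moreover have "degree (monom (a * t * s) (n - Suc m) * r) < n"
      proof -
        have "degree (monom (a * t * s) (n - Suc m) * r) \<le> (n - Suc m) + m"
          by (rule order_trans[OF degree_mult_le])
             (auto intro!: add_mono simp: degree_monom_le r_def m_def degree_reflect_poly_le)
        then show ?thesis using mn by simp
      qed
      ultimately show ?thesis unfolding p'_def n_def[symmetric] by (rule degree_add_less)
    qed
    ultimately show False using IH by blast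
  qed
  show False
  proof (cases "degree q \<le> degree p")
    case True
    show False
    proof (rule *[OF True less.prems])
      fix p' assume "degree p' < degree p" "\<forall>i. coeff p' i \<in> R" "1 = t * poly p' x"
      then show False using less.hyps[of p' q x] less.prems by simp
    qed
  next
    case False
    show False
    proof (rule *[where p = q and q = p and x = "inverse x"])
      fix p' assume "degree p' < degree q" "\<forall>i. coeff p' i \<in> R" "1 = t * poly p' (inverse x)"
      then show False using less.hyps[of p p' x] less.prems by simp
    qed (use False less.prems in auto)
  qed
qed

text \<open>
  If \<open>w\<close> is not integral over \<open>B\<close>, then \<open>t = 1 / w\<close> is not a unit of \<open>B[t]\<close>: an equation
  \<open>1 = t * p(t)\<close> multiplied by a power of \<open>w\<close> would be a monic equation for \<open>w\<close>. A subring of the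
  field that is maximal among those containing \<open>B[t]\<close> in which \<open>t\<close> is not a unit is a valuation
  ring, and it does not contain \<open>w\<close>.
\<close>

lemma integral_if_in_valuation_rings:
  fixes B :: "'a::field set" and w :: 'a
  assumes B: "subring B" and val: "\<And>R. valuation_ring R \<Longrightarrow> B \<subseteq> R \<Longrightarrow> w \<in> R"
  shows "\<exists>N\<ge>1. \<exists>b. (\<forall>i. b i \<in> B) \<and> w ^ N + (\<Sum>i=1..N. b i * w ^ (N - i)) = 0"
proof (cases "w = 0")
  case True
  then show ?thesis
    by (intro exI[of _ 1] conjI exI[of _ "\<lambda>_. 0"]) (auto simp: subringD[OF B])
next
  case w0: False
  define t where "t = inverse w"
  have t0: "t \<noteq> 0" using w0 by (simp add: t_def)
  show ?thesis
  proof (cases "\<exists>r\<in>adjoin B t. 1 = t * r")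
    case True
    then obtain p where p: "\<forall>i. coeff p i \<in> B" "1 = t * poly p t"
      by (auto simp: adjoin_def)
    define N where "N = Suc (degree p)"
    have "w ^ N = w ^ N * (t * poly p t)" using p(2) by simp
    also have "\<dots> = (\<Sum>i\<le>degree p. coeff p i * (w ^ N * (t * t ^ i)))"
      by (simp add: poly_altdef sum_distrib_left mult_ac)
    also have "\<dots> = (\<Sum>i\<le>degree p. coeff p i * w ^ (N - Suc i))"
    proof (rule sum.cong)
      fix i assume "i \<in> {..degree p}"
      then have "w ^ N = w ^ (N - Suc i) * w ^ Suc i" by (simp add: N_def flip: power_add)
      moreover have "w ^ Suc i * (t * t ^ i) = 1"
        using w0 by (simp add: t_def flip: power_Suc power_mult_distrib)
      ultimately show "coeff p i * (w ^ N * (t * t ^ i)) = coeff p i * w ^ (N - Suc i)"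
        by (simp add: mult.assoc)
    qed simp
    also have "\<dots> = (\<Sum>i=1..N. coeff p (i - 1) * w ^ (N - i))"
      by (rule sum.reindex_bij_witness[of _ "\<lambda>i. i - 1" Suc]) (auto simp: N_def)
    finally have "w ^ N + (\<Sum>i=1..N. (- coeff p (i - 1)) * w ^ (N - i)) = 0"
      by (simp add: sum_negf)
    then show ?thesis
      by (intro exI[of _ N] conjI exI[of _ "\<lambda>i. - coeff p (i - 1)"])
         (use p in \<open>auto simp: N_def subringD[OF B]\<close>)
  next
    case False
    define S where "S = {R. subring R \<and> B \<subseteq> R \<and> t \<in> R \<and> \<not> (\<exists>r\<in>R. 1 = t * r)}"
    have "\<exists>M\<in>S. \<forall>X\<in>S. M \<subseteq> X \<longrightarrow> X = M"
    proof (rule subset_Zorn_nonempty)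
      show "S \<noteq> {}" using False subring_adjoin[OF B, of t] by (auto simp: S_def)
      fix \<C> assume ne: "\<C> \<noteq> {}" and ch: "subset.chain S \<C>"
      have CS: "\<And>X. X \<in> \<C> \<Longrightarrow> X \<in> S" using ch by (auto simp: subset.chain_def)
      have "subring (\<Union>\<C>)"
        unfolding subring_def
      proof (intro conjI ballI)
        show "1 \<in> \<Union>\<C>" using ne CS by (force simp: S_def subring_def)
        fix x y assume "x \<in> \<Union>\<C>" "y \<in> \<Union>\<C>"
        then obtain X Y where XY: "X \<in> \<C>" "Y \<in> \<C>" "x \<in> X" "y \<in> Y" by auto
        then have "X \<subseteq> Y \<or> Y \<subseteq> X" using ch by (auto simp: subset.chain_def)
        then obtain Z where "Z \<in> \<C>" "x \<in> Z" "y \<in> Z" using XY by auto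
        then have "x - y \<in> Z \<and> x * y \<in> Z" using CS by (auto simp: S_def subring_def)
        then show "x - y \<in> \<Union>\<C>" "x * y \<in> \<Union>\<C>" using \<open>Z \<in> \<C>\<close> by auto
      qed
      then show "\<Union>\<C> \<in> S" using ne CS by (fastforce simp: S_def)
    qed
    then obtain R where RS: "R \<in> S" and max: "\<And>X. X \<in> S \<Longrightarrow> R \<subseteq> X \<Longrightarrow> X = R" by blast
    have R: "subring R" and BR: "B \<subseteq> R" and tR: "t \<in> R" and no: "\<And>r. r \<in> R \<Longrightarrow> 1 \<noteq> t * r"
      using RS by (auto simp: S_def)
    have rel: "\<exists>p. (\<forall>i. coeff p i \<in> R) \<and> 1 = t * poly p x" if "x \<notin> R" for x
    proof (rule ccontr)
      assume "\<nexists>p. (\<forall>i. coeff p i \<in> R) \<and> 1 = t * poly p x"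
      then have "adjoin R x \<in> S" using subring_adjoin[OF R, of x] BR tR
        by (auto simp: S_def adjoin_def)
      with max subring_adjoin[OF R, of x] that show False by blast
    qed
    \<comment> \<open>\<open>R\<close> is closed under inverting elements congruent to \<open>1\<close> modulo \<open>t\<close>, because \<open>t\<close> stays a nonunit\<close>
    have units: "1 - t * b \<noteq> 0 \<and> inverse (1 - t * b) \<in> R" if b: "b \<in> R" for b
    proof -
      define s where "s = 1 - t * b"
      have s0: "s \<noteq> 0" using no[OF b] by (auto simp: s_def)
      have sR: "s \<in> R" using b tR by (simp add: s_def subringD[OF R])
      have "inverse s \<in> R"
      proof (rule ccontr)
        assume "inverse s \<notin> R"
        then obtain p where p: "\<forall>i. coeff p i \<in> R" "1 = t * poly p (inverse s)" using rel by blast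
        define k where "k = degree p"
        have "s ^ k = t * (s ^ k * poly p (inverse s))" using p(2) by (simp add: mult.left_commute)
        also have "s ^ k * poly p (inverse s) = poly (reflect_poly p) s"
          using s0 by (simp add: k_def poly_reflect_poly_nz)
        finally have 1: "s ^ k = t * poly (reflect_poly p) s" .
        have 2: "poly (reflect_poly p) s \<in> R"
          unfolding poly_altdef using p(1) sR
          by (auto intro!: subring_sum[OF R] subringD(3)[OF R] subring_power[OF R]
              simp: coeff_reflect_poly subringD[OF R])
        have "\<exists>r\<in>R. 1 - s ^ j = t * r" for j
        proof (induction j)
          case 0 then show ?case by (auto intro!: bexI[of _ 0] simp: subringD[OF R])
        next
          case (Suc j)
          then obtain r where r: "r \<in> R" "1 - s ^ j = t * r" by auto
          have "1 - s ^ Suc j = (1 - s) + s * (1 - s ^ j)" by (simp add: algebra_simps)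
          also have "\<dots> = t * (b + s * r)" unfolding r(2) by (simp add: s_def algebra_simps)
          finally show ?case using r b sR by (auto intro!: bexI[of _ "b + s * r"] simp: subringD[OF R])
        qed
        then obtain r where r: "r \<in> R" "1 - s ^ k = t * r" by blast
        have "1 = t * (r + poly (reflect_poly p) s)"
          using r(2) 1 by (simp add: algebra_simps)
        then show False using no r 2 subringD(6)[OF R] by blast
      qed
      with s0 show ?thesis by (simp add: s_def)
    qed
    have "valuation_ring R"
    proof
      show "subring R" by (rule R)
      fix x show "x \<in> R \<or> inverse x \<in> R"
      proof (rule ccontr)
        assume neg: "\<not> ?thesis"
        then have x0: "x \<noteq> 0" using subringD(1)[OF R] by auto
        obtain p q where "\<forall>i. coeff p i \<in> R" "1 = t * poly p x"
          "\<forall>i. coeff q i \<in> R" "1 = t * poly q (inverse x)"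
          using rel neg by blast
        then show False using no_dual_relations[OF R tR units x0] by blast
      qed
    qed
    then have "w \<in> R" using val BR by blast
    then show ?thesis using no[of w] w0 by (simp add: t_def)
  qed
qed

section \<open>Filling cycles in clique complexes\<close>

text \<open>
  Integral chains are handled as functions on vertex sets, a set standing for the simplex with the
  increasing orientation. The boundary is the sum of the operators \<open>contract w\<close> over all vertices, and
  \<open>wedge u\<close> is the cone with apex \<open>u\<close>. These are interior and exterior multiplication in an exterior
  algebra, so they obey the canonical anticommutation relations, from which all the chain identities
  below follow. The complex is augmented: the empty simplex is a chain of its own.
\<close>

type_synonym schain = "nat set \<Rightarrow> int"

definition face_sign :: "nat \<Rightarrow> nat set \<Rightarrow> int" where
  "face_sign w s = (-1) ^ card {x \<in> s. x < w}"

definition wedge :: "nat \<Rightarrow> schain \<Rightarrow> schain" where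
  "wedge u c = (\<lambda>s. if u \<in> s then face_sign u (s - {u}) * c (s - {u}) else 0)"

definition contract :: "nat \<Rightarrow> schain \<Rightarrow> schain" where
  "contract u c = (\<lambda>s. if u \<in> s then 0 else face_sign u s * c (insert u s))"

definition bdry :: "nat set \<Rightarrow> schain \<Rightarrow> schain" where
  "bdry V c = (\<lambda>s. \<Sum>w\<in>V. contract w c s)"

lemma face_sign_square [simp]: "face_sign u s * face_sign u s = 1"
  by (simp add: face_sign_def flip: power_add)

lemma face_sign_insert:
  "u \<notin> s \<Longrightarrow> face_sign w (insert u s) = (if u < w then - face_sign w s else face_sign w s)"
proof -
  assume u: "u \<notin> s"
  have fin: "finite {x \<in> s. x < w}" by (rule finite_subset[of _ "{..<w}"]) auto
  show ?thesis
  proof (cases "u < w")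
    case True
    then have "{x \<in> insert u s. x < w} = insert u {x \<in> s. x < w}" by auto
    with True u fin show ?thesis by (simp add: face_sign_def)
  next
    case False
    then have "{x \<in> insert u s. x < w} = {x \<in> s. x < w}" by auto
    with False show ?thesis by (simp add: face_sign_def)
  qed
qed

lemma contract_anticommute: "contract u (contract v c) s = - contract v (contract u c) s"
proof (cases "u = v \<or> u \<in> s \<or> v \<in> s")
  case True then show ?thesis by (auto simp: contract_def)
next
  case False
  then show ?thesis
    by (cases "u < v") (auto simp: contract_def face_sign_insert insert_commute algebra_simps)
qed

lemma contract_wedge:
  "contract u (wedge v c) s = (if u = v then c s else 0) - wedge v (contract u c) s"
proof (cases "u = v")
  case True
  then show ?thesis
    by (auto simp: contract_def wedge_def mult.assoc[symmetric] insert_absorb)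
next
  case uv: False
  show ?thesis
  proof (cases "u \<in> s \<or> v \<notin> s")
    case True then show ?thesis using uv by (auto simp: contract_def wedge_def)
  next
    case False
    define t where "t = s - {v}"
    have s: "s = insert v t" "v \<notin> t" "u \<notin> t" using False by (auto simp: t_def)
    have "insert u s - {v} = insert u t" using s uv by auto
    then show ?thesis using uv s
      by (cases "u < v") (auto simp: contract_def wedge_def face_sign_insert insert_commute algebra_simps)
  qed
qed

lemma wedge_contract: "wedge u (contract u c) s = (if u \<in> s then c s else 0)"
  by (auto simp: wedge_def contract_def insert_absorb mult.assoc[symmetric])

lemma contract_diff: "contract u (\<lambda>s. a s - b s) = (\<lambda>s. contract u a s - contract u b s)"
  by (auto simp: contract_def algebra_simps)

lemma wedge_diff: "wedge u (\<lambda>s. a s - b s) = (\<lambda>s. wedge u a s - wedge u b s)"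
  by (auto simp: wedge_def algebra_simps)

lemma contract_sum: "contract u (\<lambda>s. \<Sum>w\<in>V. f w s) = (\<lambda>s. \<Sum>w\<in>V. contract u (f w) s)"
  by (auto simp: contract_def sum_distrib_left)

lemma wedge_sum: "wedge u (\<lambda>s. \<Sum>w\<in>V. f w s) = (\<lambda>s. \<Sum>w\<in>V. wedge u (f w) s)"
  by (auto simp: wedge_def sum_distrib_left)

lemma wedge_zero [simp]: "wedge u (\<lambda>_. 0) = (\<lambda>_. 0)"
  by (auto simp: wedge_def)

lemma bdry_diff: "bdry V (\<lambda>s. a s - b s) = (\<lambda>s. bdry V a s - bdry V b s)"
  by (simp add: bdry_def contract_diff sum_subtractf)

lemma bdry_contract: "bdry V (contract u c) = (\<lambda>s. - contract u (bdry V c) s)"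
  by (simp add: bdry_def contract_sum contract_anticommute[of _ u] sum_negf)

lemma bdry_wedge:
  assumes "finite V" "u \<in> V"
  shows "bdry V (wedge u c) = (\<lambda>s. c s - wedge u (bdry V c) s)"
  using assms by (simp add: bdry_def wedge_sum contract_wedge sum_subtractf)

lemma bdry_bdry: "bdry V (bdry V c) = (\<lambda>_. 0)"
proof
  fix s
  have "bdry V (bdry V c) s = (\<Sum>w\<in>V. \<Sum>u\<in>V. contract w (contract u c) s)"
    by (simp add: bdry_def contract_sum)
  also have "\<dots> = - (\<Sum>w\<in>V. \<Sum>u\<in>V. contract u (contract w c) s)"
    unfolding sum_negf[symmetric] by (intro sum.cong refl contract_anticommute)
  also have "\<dots> = - (\<Sum>u\<in>V. \<Sum>w\<in>V. contract u (contract w c) s)"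
    by (subst sum.swap) simp
  also have "\<dots> = - bdry V (bdry V c) s"
    by (simp add: bdry_def contract_sum)
  finally show "bdry V (bdry V c) s = 0" by simp
qed

text \<open>
  A graph is given by the list of its missing edges, each written with the smaller endpoint first.
  The head of the list is the edge that is deleted last.
\<close>

definition clique :: "(nat \<times> nat) list \<Rightarrow> nat set \<Rightarrow> bool" where
  "clique R s \<longleftrightarrow> (\<forall>x\<in>s. \<forall>y\<in>s. x < y \<longrightarrow> (x, y) \<notin> set R)"

definition clique_chain :: "nat set \<Rightarrow> (nat \<times> nat) list \<Rightarrow> nat \<Rightarrow> schain \<Rightarrow> bool" where
  "clique_chain S R k c \<longleftrightarrow> (\<forall>s. c s \<noteq> 0 \<longrightarrow> s \<subseteq> S \<and> card s = k \<and> clique R s)"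

definition common_nbrs :: "nat set \<Rightarrow> nat \<times> nat \<Rightarrow> (nat \<times> nat) list \<Rightarrow> nat set" where
  "common_nbrs S p R =
     {w \<in> S - {fst p, snd p}. clique R {fst p, w} \<and> clique R {snd p, w}}"

text \<open>
  A certificate that deleting the listed edges may destroy the filling of cycles: a chain of deleted
  edges, each of which lies in the link of all those deleted after it.
\<close>

fun obstruction :: "nat \<Rightarrow> nat set \<Rightarrow> (nat \<times> nat) list \<Rightarrow> bool" where
  "obstruction 0 S R = True"
| "obstruction (Suc r) S [] = False"
| "obstruction (Suc r) S (p # R) =
     (obstruction (Suc r) S R \<or>
      fst p \<in> S \<and> snd p \<in> S \<and> obstruction r (common_nbrs S p R) R)"

lemma clique_insert:
  assumes "clique R t" "\<And>w. w \<in> t \<Longrightarrow> clique R {u, w}"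
  shows "clique R (insert u t)"
  using assms unfolding clique_def by auto

lemma clique_Cons:
  assumes "fst p < snd p"
  shows "clique (p # R) s \<longleftrightarrow> clique R s \<and> \<not> (fst p \<in> s \<and> snd p \<in> s)"
  using assms unfolding clique_def by (cases p) auto

lemma clique_chain_wedge:
  assumes "finite S" "clique_chain N R k T" "N \<subseteq> S" "u \<in> S"
    and "\<And>s. s \<subseteq> N \<Longrightarrow> clique R s \<Longrightarrow> clique R' (insert u s)"
  shows "clique_chain S R' (Suc k) (wedge u T)"
  unfolding clique_chain_def
proof (intro allI impI)
  fix s assume ne: "wedge u T s \<noteq> 0"
  then have us: "u \<in> s" and t: "T (s - {u}) \<noteq> 0" by (auto simp: wedge_def split: if_splits)
  have st: "s = insert u (s - {u})" using us by auto
  have 1: "s - {u} \<subseteq> N" "card (s - {u}) = k" "clique R (s - {u})"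
    using assms(2) t by (auto simp: clique_chain_def)
  have "finite (s - {u})" using 1(1) assms(1,3) by (meson finite_subset)
  then have "card s = Suc k" using 1(2) us st by (metis card_insert_disjoint Diff_iff insertI1)
  moreover have "s \<subseteq> S" using 1 assms by auto
  moreover have "clique R' s" using assms(5)[OF 1(1,3)] st by simp
  ultimately show "s \<subseteq> S \<and> card s = Suc k \<and> clique R' s" by simp
qed

lemma clique_chain_diff:
  "clique_chain S R k a \<Longrightarrow> clique_chain S R k b \<Longrightarrow> clique_chain S R k (\<lambda>s. a s - b s)"
  unfolding clique_chain_def by (metis diff_self)

text \<open>
  Let \<open>Y\<close> fill the cycle before the last deletion, that of the edge \<open>{u, v}\<close>. The part of \<open>Y\<close> that
  contains this edge is \<open>u \<and> v \<and> Y1\<close> for a chain \<open>Y1\<close> of the link, and \<open>Y1\<close> is a cycle since the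
  boundary of \<open>Y\<close> avoids the edge. If \<open>T\<close> fills \<open>Y1\<close> in the link, then subtracting the boundary of
  \<open>u \<and> v \<and> T\<close> from \<open>Y\<close> removes the edge without changing the boundary of \<open>Y\<close>.
\<close>

lemma cycle_bounds_if_no_obstruction:
  assumes "finite V" "S \<subseteq> V" "\<forall>p\<in>set R. fst p < snd p" "\<not> obstruction (Suc d) S R"
    and "clique_chain S R k c" "bdry V c = (\<lambda>_. 0)" "k > d"
  shows "\<exists>y. clique_chain S R (Suc k) y \<and> bdry V y = c"
  using assms(2-)
proof (induction R arbitrary: S d k c)
  case Nil
  show ?case
  proof (cases "S = {}")
    case True
    have "c = (\<lambda>_. 0)"
      using Nil.prems(4,6) True by (force simp: clique_chain_def)
    then show ?thesis
      by (intro exI[of _ "\<lambda>_. 0"]) (auto simp: clique_chain_def bdry_def contract_def fun_eq_iff intro!: sum.neutral)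
  next
    case False
    then obtain u where u: "u \<in> S" by auto
    have "clique_chain S [] (Suc k) (wedge u c)"
      by (rule clique_chain_wedge[of S S "[]"])
         (use assms(1) Nil.prems u in \<open>auto simp: clique_def intro: finite_subset\<close>)
    moreover have "bdry V (wedge u c) = c"
      using bdry_wedge[of V u c] u Nil.prems(1,5) assms(1) by auto
    ultimately show ?thesis by blast
  qed
next
  case (Cons p R)
  obtain u v where p: "p = (u, v)" by (cases p)
  have uv: "u < v" using Cons.prems(2) p by auto
  have finS: "finite S" using Cons.prems(1) assms(1) finite_subset by blast
  have ltR: "\<forall>p\<in>set R. fst p < snd p" using Cons.prems(2) by simp
  have cl: "clique (p # R) s \<longleftrightarrow> clique R s \<and> \<not> (u \<in> s \<and> v \<in> s)" for s
    using clique_Cons[of p] p uv by simp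
  have cR: "clique_chain S R k c" using Cons.prems(4) by (auto simp: clique_chain_def cl)
  obtain Y where Y: "clique_chain S R (Suc k) Y" "bdry V Y = c"
    using Cons.IH[OF Cons.prems(1) ltR _ cR Cons.prems(5,6)] Cons.prems(3) by auto
  show ?case
  proof (cases "u \<in> S \<and> v \<in> S")
    case False
    then have "clique_chain S (p # R) (Suc k) Y"
      using Y(1) by (auto simp: clique_chain_def cl)
    with Y(2) show ?thesis by blast
  next
    case True
    define N where "N = common_nbrs S p R"
    have no: "\<not> obstruction d N R" using Cons.prems(3) True p by (auto simp: N_def)
    then obtain d' where d: "d = Suc d'" by (cases d) auto
    obtain k' where k: "k = Suc k'" using Cons.prems(6) by (cases k) auto
    have NS: "N \<subseteq> S" "u \<notin> N" "v \<notin> N"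
      and Nu: "\<And>w. w \<in> N \<Longrightarrow> clique R {u, w}" and Nv: "\<And>w. w \<in> N \<Longrightarrow> clique R {v, w}"
      by (auto simp: N_def common_nbrs_def p)
    define Y1 where "Y1 = contract v (contract u Y)"
    have "clique_chain N R k' Y1"
      unfolding clique_chain_def
    proof (intro allI impI)
      fix s assume "Y1 s \<noteq> 0"
      then have s: "u \<notin> s" "v \<notin> s" "Y (insert u (insert v s)) \<noteq> 0"
        by (auto simp: Y1_def contract_def split: if_splits)
      then have *: "insert u (insert v s) \<subseteq> S" "card (insert u (insert v s)) = Suc k"
        "clique R (insert u (insert v s))"
        using Y(1) by (auto simp: clique_chain_def)
      then have "finite s" using finS finite_subset by auto
      then have "card s = k'" using *(2) s uv k by simp
      moreover have "s \<subseteq> N" "clique R s"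
        using * s by (auto simp: N_def common_nbrs_def p clique_def)
      ultimately show "s \<subseteq> N \<and> card s = k' \<and> clique R s" by simp
    qed
    moreover have "bdry V Y1 = (\<lambda>_. 0)"
    proof
      fix s
      have "bdry V Y1 s = contract v (contract u c) s"
        unfolding Y1_def bdry_contract Y(2)
        by (simp add: contract_def bdry_contract Y(2))
      moreover have "c (insert u (insert v s)) = 0"
        using Cons.prems(4) by (auto simp: clique_chain_def cl)
      ultimately show "bdry V Y1 s = 0" by (simp add: contract_def)
    qed
    ultimately obtain T where T: "clique_chain N R k T" "bdry V T = Y1"
      using Cons.IH[of N d' k' Y1] NS Cons.prems(1,6) ltR no d k by auto
    define Y' where "Y' = (\<lambda>s. Y s - bdry V (wedge u (wedge v T)) s)"
    have V: "u \<in> V" "v \<in> V" using True Cons.prems(1) by auto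
    have bd: "bdry V (wedge u (wedge v T)) =
        (\<lambda>s. (wedge v T s - wedge u T s) + wedge u (wedge v Y1) s)"
      by (simp add: bdry_wedge assms(1) V T(2) wedge_diff algebra_simps)
    have "wedge u (wedge v Y1) s = (if u \<in> s \<and> v \<in> s then Y s else 0)" for s
    proof -
      have "wedge v Y1 = (\<lambda>s. if v \<in> s then contract u Y s else 0)"
        unfolding Y1_def by (simp add: wedge_contract fun_eq_iff)
      then have "wedge u (wedge v Y1) s = (if v \<in> s then wedge u (contract u Y) s else 0)"
        using uv by (auto simp: wedge_def)
      then show ?thesis by (simp add: wedge_contract)
    qed
    then have Y'_eq: "Y' = (\<lambda>s. (if u \<in> s \<and> v \<in> s then 0 else Y s) - (wedge v T s - wedge u T s))"
      unfolding Y'_def bd by auto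
    have "clique_chain S (p # R) (Suc k) (\<lambda>s. if u \<in> s \<and> v \<in> s then 0 else Y s)"
      using Y(1) by (auto simp: clique_chain_def cl)
    moreover have "clique_chain S (p # R) (Suc k) (wedge v T)"
    proof (rule clique_chain_wedge[OF finS T(1) NS(1)])
      fix s assume s: "s \<subseteq> N" "clique R s"
      have "clique R (insert v s)" by (rule clique_insert) (use Nv s in auto)
      then show "clique (p # R) (insert v s)" using s NS uv by (auto simp: cl)
    qed (use True in simp)
    moreover have "clique_chain S (p # R) (Suc k) (wedge u T)"
    proof (rule clique_chain_wedge[OF finS T(1) NS(1)])
      fix s assume s: "s \<subseteq> N" "clique R s"
      have "clique R (insert u s)" by (rule clique_insert) (use Nu s in auto)
      then show "clique (p # R) (insert u s)" using s NS uv by (auto simp: cl)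
    qed (use True in simp)
    ultimately have "clique_chain S (p # R) (Suc k) Y'"
      unfolding Y'_eq by (rule clique_chain_diff[OF _ clique_chain_diff])
    moreover have "bdry V Y' = c"
      unfolding Y'_def bdry_diff bdry_bdry Y(2) by simp
    ultimately show ?thesis by blast
  qed
qed

section \<open>Domination of squared distances\<close>

context valuation_ring
begin

text \<open>
  The divisibility preorder of a valuation ring is total. It replaces the valuation: \<open>vle x y\<close> means
  that the absolute value of \<open>x\<close> is at most that of \<open>y\<close>.
\<close>

definition vle :: "'a \<Rightarrow> 'a \<Rightarrow> bool" where
  "vle x y \<longleftrightarrow> (\<exists>r\<in>R. x = r * y)"

abbreviation vlt :: "'a \<Rightarrow> 'a \<Rightarrow> bool" where
  "vlt x y \<equiv> \<not> vle y x"

lemmas ring_closed = subringD[OF subring]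

lemma vle_refl [simp]: "vle x x"
  unfolding vle_def using ring_closed(2) by (metis mult_1)

lemma vle_zero [simp]: "vle 0 x"
  unfolding vle_def using ring_closed(1) by (metis mult_zero_left)

lemma vlt_zero [simp]: "vlt 0 x \<longleftrightarrow> x \<noteq> 0"
  unfolding vle_def using ring_closed(1) by auto

lemma vle_trans: "vle x y \<Longrightarrow> vle y z \<Longrightarrow> vle x z"
  unfolding vle_def using ring_closed(3) by (metis mult.assoc)

lemma vle_total: "vle x y \<or> vle y x"
proof (cases "y = 0 \<or> x = 0")
  case False
  then have "x / y \<in> R \<or> y / x \<in> R"
    using total[of "x / y"] by (simp add: inverse_eq_divide)
  then show ?thesis unfolding vle_def using False
    by (metis nonzero_eq_divide_eq)
qed auto

lemma vlt_imp_vle: "vlt x y \<Longrightarrow> vle x y"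
  using vle_total by blast

lemma mem_iff_vle: "x \<in> R \<longleftrightarrow> vle x 1"
  by (auto simp: vle_def)

lemma vle_mult: "vle a b \<Longrightarrow> vle c d \<Longrightarrow> vle (a * c) (b * d)"
  unfolding vle_def using ring_closed(3) by (metis mult.assoc mult.left_commute)

lemma vle_mult_cancel: "c \<noteq> 0 \<Longrightarrow> vle (a * c) (b * c) \<Longrightarrow> vle a b"
  unfolding vle_def by (auto simp flip: mult.assoc)

lemma vlt_mult:
  assumes "vle a b" "b \<noteq> 0" "vlt c d"
  shows "vlt (a * c) (b * d)"
proof
  assume "vle (b * d) (a * c)"
  then have "vle (d * b) (c * b)"
    using vle_trans[OF _ vle_mult[OF assms(1) vle_refl[of c]]] by (simp add: mult.commute)
  then show False using vle_mult_cancel assms by blast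
qed

lemma vlt_square: "vlt (a\<^sup>2) (b\<^sup>2) \<Longrightarrow> vlt a b"
  using vle_mult[of b a b a] by (auto simp: power2_eq_square)

lemma vle_add: "vle x z \<Longrightarrow> vle y z \<Longrightarrow> vle (x + y) z"
  unfolding vle_def using ring_closed(6) by (metis distrib_right)

lemma vlt_add: "vlt x z \<Longrightarrow> vlt y z \<Longrightarrow> vlt (x + y) z"
  using vle_total[of x y] vle_add[of x y y] vle_add[of x x y] vle_trans by (metis vle_refl)

lemma vlt_sum: "z \<noteq> 0 \<Longrightarrow> (\<And>i. i \<in> I \<Longrightarrow> vlt (f i) z) \<Longrightarrow> vlt (sum f I) z"
proof (induction I rule: infinite_finite_induct)
  case (insert i I)
  then show ?case using vlt_add[of _ "f i" "sum f I"] by simp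
qed auto

lemma vle_uminus: "vle x (- y) \<longleftrightarrow> vle x y"
  unfolding vle_def using ring_closed(5) by (metis minus_mult_commute minus_mult_minus)

lemma mem_if_square_mem:
  assumes "x\<^sup>2 \<in> R" shows "x \<in> R"
proof (rule ccontr)
  assume "x \<notin> R"
  then have lt: "vlt 1 x" by (simp add: mem_iff_vle)
  have "vle (1 * x) (x * x)" by (rule vle_mult[OF vlt_imp_vle[OF lt] vle_refl])
  then have "vle x 1" using assms vle_trans by (auto simp: mem_iff_vle power2_eq_square)
  with lt show False by simp
qed

lemma exists_vle_max:
  "finite I \<Longrightarrow> I \<noteq> {} \<Longrightarrow> \<exists>y\<in>I. \<forall>z\<in>I. vle (f z) (f y)"
proof (induction I rule: finite_ne_induct)
  case (insert x I)
  then obtain y where "y \<in> I" "\<forall>z\<in>I. vle (f z) (f y)" by auto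
  then show ?case using vle_total[of "f x" "f y"] vle_trans vle_refl
    by (metis insert_iff)
qed auto

text \<open>
  Each row of \<open>L\<close> has the distinguished entry \<open>A y\<close> in the column \<open>y\<close> of its partner. Rescaling the
  variable \<open>c y\<close> by the square root of \<open>A y\<close> would turn these entries into units and all others into
  entries of absolute value at most one, and strictly less unless the rank increases. The matrix is
  then triangular modulo the maximal ideal. To avoid square roots, a kernel vector is examined at a
  coordinate \<open>y\<close> for which \<open>f y\<close>, the square of the rescaled coordinate, is maximal, and whose rank
  is maximal among those: in the row of its partner, the term of \<open>y\<close> strictly dominates the others.
\<close>

lemma dominated_kernel_trivial:
  assumes fin: "finite I"
    and partner: "\<And>y. y \<in> I \<Longrightarrow> p y \<in> I \<and> L (p y) y = A y \<and> A y \<noteq> 0"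
    and dom: "\<And>y z. y \<in> I \<Longrightarrow> z \<in> I \<Longrightarrow> z \<noteq> y \<Longrightarrow>
      vle ((L (p y) z)\<^sup>2) (A y * A z) \<and>
      (vlt ((L (p y) z)\<^sup>2) (A y * A z) \<or> (rank y :: nat) < rank z)"
    and ker: "\<And>x. x \<in> I \<Longrightarrow> (\<Sum>z\<in>I. L x z * c z) = 0"
    and "y0 \<in> I"
  shows "c y0 = 0"
proof (rule ccontr)
  assume c0: "c y0 \<noteq> 0"
  define f where "f = (\<lambda>y. (c y)\<^sup>2 * A y)"
  define M where "M = {y \<in> I. \<forall>z\<in>I. vle (f z) (f y)}"
  have "M \<noteq> {}" using exists_vle_max[of I f] fin \<open>y0 \<in> I\<close> by (auto simp: M_def)
  moreover have "finite M" using fin by (auto simp: M_def)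
  ultimately have "\<exists>y\<in>M. \<forall>z\<in>M. rank z \<le> rank y"
    using Max_in[of "rank ` M"] Max_ge[of "rank ` M"] by fastforce
  then obtain y where y: "y \<in> M" "\<And>z. z \<in> M \<Longrightarrow> rank z \<le> rank y" by blast
  have yI: "y \<in> I" and ymax: "\<And>z. z \<in> I \<Longrightarrow> vle (f z) (f y)" using y by (auto simp: M_def)
  have A0: "\<And>z. z \<in> I \<Longrightarrow> A z \<noteq> 0" using partner by blast
  have "f y0 \<noteq> 0" using c0 A0 \<open>y0 \<in> I\<close> by (simp add: f_def)
  then have fy: "f y \<noteq> 0" using ymax[OF \<open>y0 \<in> I\<close>] vlt_zero[of "f y0"] by force
  then have cy: "c y \<noteq> 0" by (auto simp: f_def)
  have small: "vlt (L (p y) z * c z) (A y * c y)" if z: "z \<in> I - {y}" for z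
  proof -
    have zI: "z \<in> I" and zy: "z \<noteq> y" using z by auto
    note d = dom[OF yI zI zy]
    have AA: "A y * A z \<noteq> 0" using A0 yI zI by simp
    have "vlt ((L (p y) z)\<^sup>2 * f z) ((A y * A z) * f y)"
    proof (cases "vlt ((L (p y) z)\<^sup>2) (A y * A z)")
      case True
      then show ?thesis using vlt_mult[OF ymax[OF zI] fy True] by (simp add: mult.commute)
    next
      case False
      then have "z \<notin> M" using d y(2) by force
      then obtain z' where "z' \<in> I" "vlt (f z) (f z')" using zI by (auto simp: M_def)
      then have "vlt (f z) (f y)" using ymax vle_trans by blast
      then show ?thesis using vlt_mult[OF _ AA] d by blast
    qed
    then have "vlt ((L (p y) z * c z)\<^sup>2 * A z) ((A y * c y)\<^sup>2 * A z)"
      by (simp add: f_def power2_eq_square mult_ac)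
    then have "vlt ((L (p y) z * c z)\<^sup>2) ((A y * c y)\<^sup>2)"
      using vle_mult[OF _ vle_refl] by blast
    then show ?thesis by (rule vlt_square)
  qed
  have "(\<Sum>z\<in>I. L (p y) z * c z) = A y * c y + (\<Sum>z\<in>I - {y}. L (p y) z * c z)"
    using partner[OF yI] by (simp add: sum.remove[OF fin yI])
  then have "(\<Sum>z\<in>I - {y}. L (p y) z * c z) = - (A y * c y)"
    using ker partner[OF yI] by (simp add: eq_neg_iff_add_eq_0 add.commute)
  moreover have "vlt (\<Sum>z\<in>I - {y}. L (p y) z * c z) (A y * c y)"
    using small A0 yI cy by (intro vlt_sum) auto
  ultimately show False by (simp add: vle_uminus)
qed

end

lemma underdetermined_system:
  fixes \<psi> :: "nat \<Rightarrow> 'i \<Rightarrow> 'a::field"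
  assumes "finite I" "card I > m"
  shows "\<exists>c. (\<exists>y\<in>I. c y \<noteq> 0) \<and> (\<forall>k<m. (\<Sum>y\<in>I. \<psi> k y * c y) = 0)"
  using assms
proof (induction m arbitrary: I \<psi>)
  case 0
  then have "I \<noteq> {}" by auto
  then show ?case by (intro exI[of _ "\<lambda>_. 1"]) auto
next
  case (Suc m)
  show ?case
  proof (cases "\<forall>y\<in>I. \<psi> m y = 0")
    case True
    obtain c where "\<exists>y\<in>I. c y \<noteq> 0" "\<forall>k<m. (\<Sum>y\<in>I. \<psi> k y * c y) = 0"
      using Suc.IH[of I \<psi>] Suc.prems by auto
    then show ?thesis using True by (intro exI[of _ c]) (auto simp: less_Suc_eq)
  next
    case False
    then obtain x where x: "x \<in> I" "\<psi> m x \<noteq> 0" by auto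
    define \<psi>' where "\<psi>' = (\<lambda>k y. \<psi> k y - \<psi> k x * \<psi> m y / \<psi> m x)"
    have "card (I - {x}) > m" using Suc.prems x by simp
    then obtain c where c: "\<exists>y\<in>I - {x}. c y \<noteq> 0"
      "\<forall>k<m. (\<Sum>y\<in>I - {x}. \<psi>' k y * c y) = 0"
      using Suc.IH[of "I - {x}" \<psi>'] Suc.prems by auto
    define s where "s = (\<Sum>y\<in>I - {x}. \<psi> m y * c y)"
    define c' where "c' = c(x := - s / \<psi> m x)"
    have sum_c': "(\<Sum>y\<in>I. \<psi> k y * c' y) =
        - \<psi> k x * s / \<psi> m x + (\<Sum>y\<in>I - {x}. \<psi> k y * c y)" for k
      using Suc.prems x by (simp add: sum.remove[of I x] c'_def)
    have "(\<Sum>y\<in>I. \<psi> k y * c' y) = 0" if "k < Suc m" for k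
    proof (cases "k = m")
      case True
      then show ?thesis using x by (simp add: sum_c' s_def)
    next
      case False
      have "(\<Sum>y\<in>I - {x}. \<psi>' k y * c y) =
          (\<Sum>y\<in>I - {x}. \<psi> k y * c y) - \<psi> k x / \<psi> m x * s"
        by (simp add: \<psi>'_def s_def algebra_simps sum_subtractf sum_distrib_left)
      then show ?thesis using c(2) False that by (simp add: sum_c')
    qed
    moreover have "\<exists>y\<in>I. c' y \<noteq> 0" using c(1) by (auto simp: c'_def)
    ultimately show ?thesis by blast
  qed
qed

text \<open>
  The edge \<open>q\<close> is deleted earlier than \<open>p\<close> (earlier deletions come later in the list), and each edge
  between them is deleted after \<open>p\<close> or not at all.
\<close>

definition cross_after ::
    "(nat \<times> nat \<Rightarrow> nat \<times> nat \<Rightarrow> bool) \<Rightarrow> (nat \<times> nat) set \<Rightarrow> nat \<times> nat \<Rightarrow> nat \<times> nat \<Rightarrow> bool" where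
  "cross_after before Q p q \<longleftrightarrow> before p q \<and> (\<forall>x\<in>{fst p, snd p}. \<forall>y\<in>{fst q, snd q}. x \<noteq> y \<and>
     ((min x y, max x y) \<in> Q \<longrightarrow> before (min x y, max x y) p))"

text \<open>
  The prefix \<open>R1\<close> collects the edges deleted after those of \<open>R\<close>; it is empty in the application
  and grows along the recursion, so that the conclusion speaks of all deleted edges throughout.
\<close>

lemma obstruction_pairs:
  assumes "obstruction r S R" "sorted_wrt before (R1 @ R)"
  shows "\<exists>ps. length ps = r \<and> set ps \<subseteq> set R \<and> (\<forall>q\<in>set ps. fst q \<in> S \<and> snd q \<in> S) \<and>
    sorted_wrt (cross_after before (set (R1 @ R))) ps"
  using assms
proof (induction r S R arbitrary: R1 rule: obstruction.induct)
  case (3 r S p R)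
  have tl: "(R1 @ [p]) @ R = R1 @ p # R" by simp
  show ?case
  proof (cases "obstruction (Suc r) S R")
    case True
    obtain ps where "length ps = Suc r" "set ps \<subseteq> set R"
      "\<forall>q\<in>set ps. fst q \<in> S \<and> snd q \<in> S" "sorted_wrt (cross_after before (set (R1 @ p # R))) ps"
      using "3.IH"(1)[OF True, of "R1 @ [p]"] "3.prems"(2) unfolding tl by blast
    then show ?thesis by (intro exI[of _ ps]) auto
  next
    case False
    then have pS: "fst p \<in> S" "snd p \<in> S" and ob: "obstruction r (common_nbrs S p R) R"
      using "3.prems"(1) by auto
    obtain ps where ps: "length ps = r" "set ps \<subseteq> set R"
      "\<And>q. q \<in> set ps \<Longrightarrow> fst q \<in> common_nbrs S p R \<and> snd q \<in> common_nbrs S p R"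
      "sorted_wrt (cross_after before (set (R1 @ p # R))) ps"
      using "3.IH"(2)[OF ob, of "R1 @ [p]"] "3.prems"(2) unfolding tl by blast
    have "cross_after before (set (R1 @ p # R)) p q" if q: "q \<in> set ps" for q
      unfolding cross_after_def
    proof (intro conjI ballI impI)
      show "before p q" using "3.prems"(2) q ps(2) by (auto simp: sorted_wrt_append)
      fix x y assume x: "x \<in> {fst p, snd p}" and y: "y \<in> {fst q, snd q}"
      then have yn: "y \<in> common_nbrs S p R" using ps(3)[OF q] by auto
      show ne: "x \<noteq> y" using x yn by (auto simp: common_nbrs_def)
      assume e: "(min x y, max x y) \<in> set (R1 @ p # R)"
      have "clique R {x, y}" using x yn by (auto simp: common_nbrs_def)
      then have "(min x y, max x y) \<notin> set R"
        using ne by (cases "x < y") (auto simp: clique_def min_def max_def)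
      moreover have "(min x y, max x y) \<noteq> p"
        using yn by (auto simp: common_nbrs_def min_def max_def split: if_splits)
      ultimately have "(min x y, max x y) \<in> set R1" using e by auto
      then show "before (min x y, max x y) p" using "3.prems"(2) by (auto simp: sorted_wrt_append)
    qed
    moreover have "fst q \<in> S \<and> snd q \<in> S" if "q \<in> set ps" for q
      using ps(3)[OF that] by (auto simp: common_nbrs_def)
    ultimately show ?thesis
      using ps pS by (intro exI[of _ "p # ps"]) auto
  qed
qed auto

context valuation_ring
begin

text \<open>
  Pairs at a larger distance come later, that is, they are deleted earlier; among pairs at equally
  large distance, those with the smaller first endpoint are deleted earlier. Without this second
  criterion, all cross distances between equally far pairs could be as large as the distances inside
  the pairs, and the distance matrix of an obstruction could be singular.
\<close>

definition removal_order :: "(nat \<Rightarrow> nat \<Rightarrow> 'a) \<Rightarrow> nat \<times> nat \<Rightarrow> nat \<times> nat \<Rightarrow> bool" where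
  "removal_order l p q \<longleftrightarrow> vle (l (fst p) (snd p)) (l (fst q) (snd q)) \<and>
     (vle (l (fst q) (snd q)) (l (fst p) (snd p)) \<longrightarrow> fst q \<le> fst p)"

text \<open>
  The vertices of an obstruction are indexed by pairs \<open>(i, b)\<close>, where \<open>b\<close> tells whether the second
  endpoint is meant. A cross distance between the pairs \<open>i < j\<close> is at most \<open>a i\<close>, which is at most
  \<open>a j\<close>. If \<open>a i\<close> and \<open>a j\<close> are equally large, then a cross distance at the first endpoint of the pair
  \<open>j\<close> is even smaller, by the second criterion of the order of deletion. So the only cross entries
  that are not strictly dominated are at the second endpoint of the pair \<open>j\<close>, and the rank \<open>rk\<close> is
  chosen such that it increases along all of them.
\<close>

lemma obstruction_length:
  fixes l :: "nat \<Rightarrow> nat \<Rightarrow> 'a"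
  assumes sym: "\<And>x y. l x y = l y x" and diag: "\<And>x. l x x = 0"
    and rank: "\<And>x y. l x y = (\<Sum>k<m. \<phi> k x * \<psi> k y)"
    and far: "set Q = {(x, y). x < y \<and> x \<in> V \<and> y \<in> V \<and> l x y \<notin> R}"
    and sorted: "sorted_wrt (removal_order l) Q"
    and ob: "obstruction r V Q"
  shows "2 * r \<le> m"
proof (rule ccontr)
  assume "\<not> ?thesis"
  then have rm: "2 * r > m" by simp
  obtain ps where len: "length ps = r" and psQ: "set ps \<subseteq> set Q"
    and wrt: "sorted_wrt (cross_after (removal_order l) (set Q)) ps"
    using obstruction_pairs[OF ob, of "removal_order l" "[]"] sorted by auto
  define a where "a = (\<lambda>i. l (fst (ps ! i)) (snd (ps ! i)))"
  have inQ: "ps ! i \<in> set Q" if "i < r" for i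
    using nth_mem[of i ps] that len psQ by blast
  have aR: "a i \<notin> R" if "i < r" for i
    using inQ[OF that] unfolding far a_def by (simp add: split_beta)
  have min_max: "l (min x y) (max x y) = l x y" for x y
    using sym by (simp add: min_def max_def)
  have cross: "vle (a i) (a j) \<and> vle (l x y) (a i) \<and>
      (vle (a j) (a i) \<and> y = fst (ps ! j) \<longrightarrow> vlt (l x y) (a i))"
    if ij: "i < j" "j < r" and x: "x \<in> {fst (ps ! i), snd (ps ! i)}"
      and y: "y \<in> {fst (ps ! j), snd (ps ! j)}" for i j x y
  proof -
    have "cross_after (removal_order l) (set Q) (ps ! i) (ps ! j)"
      by (rule sorted_wrt_nth_less[OF wrt ij(1)]) (simp add: ij len)
    note H = this[unfolded cross_after_def]
    from H have *: "removal_order l (ps ! i) (ps ! j)" by (rule conjunct1)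
    from H x y have ne1: "x \<noteq> y" by blast
    from H have ne2: "fst (ps ! i) \<noteq> fst (ps ! j)" by blast
    note ne = ne1 ne2
    from H x y have e: "(min x y, max x y) \<in> set Q \<Longrightarrow> removal_order l (min x y, max x y) (ps ! i)"
      by blast
    show ?thesis
    proof (cases "(min x y, max x y) \<in> set Q")
      case True
      then show ?thesis
        using e * ne(2) by (auto simp: removal_order_def a_def min_max)
    next
      case False
      have "ps ! i \<in> set Q" "ps ! j \<in> set Q" using inQ ij by auto
      then have "x \<in> V" "y \<in> V" using x y unfolding far by auto
      then have "l x y \<in> R" using False ne(1) min_max[of x y]
        unfolding far by (auto simp: min_def max_def split: if_splits)
      then have "vlt (l x y) (a i)" using aR[of i] ij vle_trans by (auto simp: mem_iff_vle)
      then show ?thesis using * vlt_imp_vle by (auto simp: removal_order_def a_def)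
    qed
  qed
  define I where "I = {..<r} \<times> (UNIV :: bool set)"
  define pt where "pt = (\<lambda>(i, b). if b then snd (ps ! i) else fst (ps ! i))"
  define partner where "partner = (\<lambda>(i :: nat, b). (i, \<not> b))"
  define rk where "rk = (\<lambda>(i, b). if b then r + i else r - 1 - i)"
  have finI: "finite I" and "card I > m" using rm by (auto simp: I_def card_cartesian_product)
  then obtain c where c: "\<exists>y\<in>I. c y \<noteq> 0" "\<forall>k<m. (\<Sum>y\<in>I. \<psi> k (pt y) * c y) = 0"
    using underdetermined_system[of I m "\<lambda>k y. \<psi> k (pt y)"] by blast
  have ker: "(\<Sum>z\<in>I. l (pt x) (pt z) * c z) = 0" for x
  proof -
    have "(\<Sum>z\<in>I. l (pt x) (pt z) * c z) = (\<Sum>z\<in>I. \<Sum>k<m. \<phi> k (pt x) * (\<psi> k (pt z) * c z))"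
      by (simp add: rank sum_distrib_right mult.assoc)
    also have "\<dots> = (\<Sum>k<m. \<phi> k (pt x) * (\<Sum>z\<in>I. \<psi> k (pt z) * c z))"
      by (subst sum.swap) (simp add: sum_distrib_left)
    finally show ?thesis using c(2) by simp
  qed
  have "c y = 0" if "y \<in> I" for y
  proof (rule dominated_kernel_trivial[OF finI _ _ _ that,
        where L = "\<lambda>x z. l (pt x) (pt z)" and p = partner and A = "a \<circ> fst" and rank = rk])
    fix y assume "y \<in> I"
    then show "partner y \<in> I \<and> l (pt (partner y)) (pt y) = (a \<circ> fst) y \<and> (a \<circ> fst) y \<noteq> 0"
      using aR[of "fst y"] ring_closed(1) sym
      by (auto simp: I_def partner_def pt_def a_def split: prod.splits)
  next
    fix y z assume yI: "y \<in> I" and zI: "z \<in> I" and zy: "z \<noteq> y"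
    obtain i b j b' where yz: "y = (i, b)" "z = (j, b')" by (cases y, cases z)
    have ij: "i < r" "j < r" using yI zI yz by (auto simp: I_def)
    have A: "(a \<circ> fst) y = a i" "(a \<circ> fst) z = a j" by (simp_all add: yz)
    have a0: "a i \<noteq> 0" "a j \<noteq> 0" using aR ring_closed(1) ij by metis+
    let ?x = "pt (partner y)" and ?z = "pt z"
    show "vle ((l ?x ?z)\<^sup>2) ((a \<circ> fst) y * (a \<circ> fst) z) \<and>
      (vlt ((l ?x ?z)\<^sup>2) ((a \<circ> fst) y * (a \<circ> fst) z) \<or> rk y < rk z)"
    proof (cases "i = j")
      case True
      then have "?x = ?z" using zy yz by (auto simp: partner_def pt_def)
      then show ?thesis using a0 by (simp add: yz diag)
    next
      case False
      have px: "?x \<in> {fst (ps ! i), snd (ps ! i)}" "?z \<in> {fst (ps ! j), snd (ps ! j)}"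
        by (auto simp: yz partner_def pt_def)
      \<comment> \<open>\<open>X\<close> is a cross distance, \<open>g\<close> the pair that is deleted later and \<open>h\<close> the other one\<close>
      have gen: "vle (X\<^sup>2) (a i * a j) \<and> (vlt (X\<^sup>2) (a i * a j) \<or> vle (a h) (a g) \<and> vle (a g) X)"
        if gh: "{g, h} = {i, j}" "vle (a g) (a h)" "vle X (a g)" for X g h
      proof -
        have aa: "a i * a j = a g * a h" using gh(1) by (auto simp: doubleton_eq_iff mult.commute)
        have gh0: "a g \<noteq> 0" "a h \<noteq> 0" using gh(1) a0 by (auto simp: doubleton_eq_iff)
        have "vle X (a h)" using gh vle_trans by blast
        then have 1: "vle (X\<^sup>2) (a g * a h)" using vle_mult[OF gh(3)] by (simp add: power2_eq_square)
        have 2: "vlt (X\<^sup>2) (a g * a h)" if "vlt X (a h)"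
          using vlt_mult[OF gh(3) gh0(1) that] by (simp add: power2_eq_square)
        have 3: "vlt X (a h)" if "vlt X (a g) \<or> vlt (a g) (a h)"
          using that gh vle_trans by blast
        show ?thesis using 1 2 3 aa by auto
      qed
      show ?thesis
      proof (cases "i < j")
        case True
        note cr = cross[OF True ij(2) px]
        have "rk y < rk z \<or> ?z = fst (ps ! j)"
          using True ij by (cases b') (auto simp: rk_def yz pt_def)
        then show ?thesis unfolding A using gen[of i j "l ?x ?z"] cr by blast
      next
        case F: False
        then have ji: "j < i" using False by simp
        note cr = cross[OF ji ij(1) px(2,1)]
        have "rk y < rk z \<or> ?x = fst (ps ! i)"
          using ji ij by (cases b) (auto simp: rk_def yz pt_def partner_def)
        then show ?thesis
          unfolding A sym[of ?x ?z] using gen[of j i "l ?z ?x"] cr by blast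
      qed
    qed
  qed (use ker in auto)
  with c(1) show False by blast
qed

lemma removal_order_list:
  assumes "finite F"
  shows "\<exists>Q. set Q = F \<and> sorted_wrt (removal_order l) Q"
  using assms
proof (induction "card F" arbitrary: F)
  case 0
  then show ?case by auto
next
  case (Suc k)
  then have "F \<noteq> {}" by auto
  define M where "M = {p \<in> F. \<forall>q\<in>F. vle (l (fst q) (snd q)) (l (fst p) (snd p))}"
  obtain p0 where "p0 \<in> F" "\<forall>q\<in>F. vle (l (fst q) (snd q)) (l (fst p0) (snd p0))"
    using exists_vle_max[OF \<open>finite F\<close> \<open>F \<noteq> {}\<close>, of "\<lambda>p. l (fst p) (snd p)"] by metis
  then have "M \<noteq> {}" unfolding M_def by blast
  have finM: "finite (fst ` M)" using Suc.prems by (simp add: M_def)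
  have "Min (fst ` M) \<in> fst ` M" using \<open>M \<noteq> {}\<close> finM by (intro Min_in) auto
  then obtain p where pM: "p \<in> M" and pmin: "Min (fst ` M) = fst p" by auto
  have p: "p \<in> M" "\<And>q. q \<in> M \<Longrightarrow> fst p \<le> fst q"
    using pM Min_le[OF finM] unfolding pmin by auto
  have "p \<in> F" using p by (simp add: M_def)
  then obtain Q where Q: "set Q = F - {p}" "sorted_wrt (removal_order l) Q"
    using Suc.hyps(1)[of "F - {p}"] Suc.hyps(2)[symmetric] Suc.prems by (auto simp: card_Diff_singleton)
  have "removal_order l q p" if "q \<in> F" for q
  proof -
    have "q \<in> M" if le: "vle (l (fst p) (snd p)) (l (fst q) (snd q))"
    proof -
      have "vle (l (fst q') (snd q')) (l (fst q) (snd q))" if "q' \<in> F" for q'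
        using p(1) that vle_trans[OF _ le] by (simp add: M_def)
      then show ?thesis using \<open>q \<in> F\<close> by (simp add: M_def)
    qed
    then show ?thesis using p \<open>q \<in> F\<close> by (auto simp: removal_order_def M_def)
  qed
  then show ?case using Q \<open>p \<in> F\<close> by (intro exI[of _ "Q @ [p]"]) (auto simp: sorted_wrt_append)
qed

end

section \<open>Volumes of simplices\<close>

definition points_det :: "nat \<Rightarrow> (nat \<Rightarrow> nat \<Rightarrow> 'a::comm_ring_1) \<Rightarrow> nat set \<Rightarrow> 'a" where
  "points_det n P s = det (mat n n (\<lambda>(i, j). P (sorted_list_of_set s ! j) i))"

definition sq_dist :: "nat \<Rightarrow> (nat \<Rightarrow> nat \<Rightarrow> 'a::comm_ring_1) \<Rightarrow> nat \<Rightarrow> nat \<Rightarrow> 'a" where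
  "sq_dist n P x y = (\<Sum>i<n. (P x i - P y i)\<^sup>2)"

lemma det_cong_mod:
  fixes A B :: "'a::comm_ring_1 mat"
  assumes R: "subring R" and A: "A \<in> carrier_mat n n" and B: "B \<in> carrier_mat n n"
    and AR: "\<And>i j. i < n \<Longrightarrow> j < n \<Longrightarrow> A $$ (i, j) \<in> R"
    and cong: "\<And>i j. i < n \<Longrightarrow> j < n \<Longrightarrow> \<exists>r\<in>R. A $$ (i, j) - B $$ (i, j) = c * r"
    and c: "c \<in> R"
  shows "\<exists>r\<in>R. det A - det B = c * r"
proof -
  note Rs = subringD[OF R]
  define I where "I = (\<lambda>x. \<exists>r\<in>R. x = c * r)"
  have I0: "I 0" unfolding I_def using Rs(1) by (metis mult_zero_right)
  have Iadd: "I (x + y)" if "I x" "I y" for x y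
    using that unfolding I_def using Rs(6) by (metis distrib_left)
  have Imult: "I (r * x)" if "I x" "r \<in> R" for x r
    using that unfolding I_def using Rs(3) by (metis mult.left_commute)
  have Isum: "I (sum f S)" if "\<And>x. x \<in> S \<Longrightarrow> I (f x)" for f and S :: "'s set"
    using that by (induction S rule: infinite_finite_induct) (auto intro: Iadd I0)
  have mem: "x \<in> R" if yx: "I (y - x)" and y: "y \<in> R" for x y
  proof -
    obtain r where r: "r \<in> R" "y - x = c * r" using yx unfolding I_def by blast
    then have "x = y - c * r" by (metis diff_diff_eq2 add_diff_cancel_left')
    with r show ?thesis using y c Rs by auto
  qed
  have BR: "B $$ (i, j) \<in> R" if "i < n" "j < n" for i j
    using mem[of "A $$ (i, j)"] cong[OF that] AR[OF that] by (auto simp: I_def)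
  have prod: "I (prod f S - prod g S)"
    if "finite S" "\<And>x. x \<in> S \<Longrightarrow> f x \<in> R \<and> g x \<in> R \<and> I (f x - g x)" for f g and S :: "nat set"
    using that
  proof (induction S rule: finite_induct)
    case (insert x S)
    have eq: "prod f (insert x S) - prod g (insert x S) =
        f x * (prod f S - prod g S) + prod g S * (f x - g x)"
      using insert.hyps by (simp add: algebra_simps)
    have "prod g S \<in> R" using insert.prems by (intro subring_prod[OF R]) auto
    then show ?case unfolding eq using insert by (intro Iadd Imult) auto
  qed (simp add: I0)
  have "det A - det B = (\<Sum>p\<in>{p. p permutes {0..<n}}. signof p *
      ((\<Prod>i = 0..<n. A $$ (i, p i)) - (\<Prod>i = 0..<n. B $$ (i, p i))))"
    unfolding det_def'[OF A] det_def'[OF B] by (simp add: sum_subtractf algebra_simps)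
  also have "I \<dots>"
  proof (rule Isum)
    fix p assume "p \<in> {p. p permutes {0..<n}}"
    then have p: "p permutes {0..<n}" by simp
    have "p i < n" if "i < n" for i using permutes_in_image[OF p, of i] that by simp
    then have "I ((\<Prod>i = 0..<n. A $$ (i, p i)) - (\<Prod>i = 0..<n. B $$ (i, p i)))"
      using AR BR cong by (intro prod) (auto simp: I_def)
    moreover have "signof p \<in> R" using subring_of_int[OF R, of "sign p"] by (simp add: sign_def)
    ultimately show "I (signof p * ((\<Prod>i = 0..<n. A $$ (i, p i)) - (\<Prod>i = 0..<n. B $$ (i, p i))))"
      by (intro Imult) auto
  qed
  finally show ?thesis by (simp add: I_def)
qed

lemma det_mem_subring:
  fixes A :: "'a::comm_ring_1 mat"
  assumes R: "subring R" and A: "A \<in> carrier_mat n n"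
    and AR: "\<And>i j. i < n \<Longrightarrow> j < n \<Longrightarrow> A $$ (i, j) \<in> R"
  shows "det A \<in> R"
  unfolding det_def'[OF A]
proof (intro subring_sum[OF R] subringD(3)[OF R] subring_prod[OF R])
  fix p i assume "p \<in> {p. p permutes {0..<n}}" "i \<in> {0..<n}"
  then show "A $$ (i, p i) \<in> R" using permutes_in_image[of p "{0..<n}" i] by (auto intro: AR)
next
  fix p :: "nat \<Rightarrow> nat"
  show "signof p \<in> R" using subring_of_int[OF R, of "sign p"] by (simp add: sign_def)
qed

lemma det_skew_odd:
  fixes A :: "'a::idom mat"
  assumes A: "A \<in> carrier_mat n n" and "odd n" "(2 :: 'a) \<noteq> 0"
    and skew: "\<And>i j. i < n \<Longrightarrow> j < n \<Longrightarrow> A $$ (j, i) = - A $$ (i, j)"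
  shows "det A = 0"
proof -
  have "transpose_mat A = (-1) \<cdot>\<^sub>m A"
  proof (rule eq_matI)
    fix i j assume "i < dim_row ((-1) \<cdot>\<^sub>m A)" "j < dim_col ((-1) \<cdot>\<^sub>m A)"
    then show "transpose_mat A $$ (i, j) = ((-1) \<cdot>\<^sub>m A) $$ (i, j)"
      using A skew[of i j] by simp
  qed (use A in auto)
  then have "det A = (-1) ^ n * det A"
    using det_transpose[OF A] det_smult[of "-1" A] A by auto
  then have "2 * det A = 0" using \<open>odd n\<close> by simp
  then show ?thesis using assms(3) by simp
qed

text \<open>
  Modulo \<open>2\<close> the matrix agrees with a skew-symmetric one, whose determinant vanishes as its size is
  odd.
\<close>

lemma det_symmetric_even_diagonal:
  fixes A :: "'a::idom mat"
  assumes R: "subring R" and A: "A \<in> carrier_mat n n" and "odd n" "(2 :: 'a) \<noteq> 0"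
    and AR: "\<And>i j. i < n \<Longrightarrow> j < n \<Longrightarrow> A $$ (i, j) \<in> R"
    and sym: "\<And>i j. i < n \<Longrightarrow> j < n \<Longrightarrow> A $$ (j, i) = A $$ (i, j)"
    and diag: "\<And>i. i < n \<Longrightarrow> \<exists>r\<in>R. A $$ (i, i) = 2 * r"
  shows "\<exists>r\<in>R. det A = 2 * r"
proof -
  define B where "B = mat n n (\<lambda>(i, j). if i < j then A $$ (i, j) else if i = j then 0 else - A $$ (i, j))"
  have B: "B \<in> carrier_mat n n" by (simp add: B_def)
  have "det B = 0"
    by (rule det_skew_odd[OF B \<open>odd n\<close> assms(4)]) (auto simp: B_def sym)
  moreover have "\<exists>r\<in>R. det A - det B = 2 * r"
  proof (rule det_cong_mod[OF R A B AR])
    show "2 \<in> R" using subringD(2,6)[OF R] by (metis one_add_one)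
    fix i j assume ij: "i < n" "j < n"
    consider "i < j" | "i = j" | "j < i" by linarith
    then show "\<exists>r\<in>R. A $$ (i, j) - B $$ (i, j) = 2 * r"
    proof cases
      case 1 then show ?thesis using ij subringD(1)[OF R] by (auto simp: B_def intro!: bexI[of _ 0])
    next
      case 2 then show ?thesis using ij diag by (auto simp: B_def)
    next
      case 3 then show ?thesis using ij AR by (auto simp: B_def intro!: bexI[of _ "A $$ (i, j)"])
    qed
  qed auto
  ultimately show ?thesis by simp
qed

text \<open>
  Both sides are the determinant of the matrix with columns \<open>(1, P j)\<close>: expand along the row of ones
  directly, or after subtracting the first column from the others.
\<close>

lemma bordered_det:
  fixes P :: "nat \<Rightarrow> nat \<Rightarrow> 'a::comm_ring_1"
  shows "det (mat n n (\<lambda>(i, j). P (Suc j) i - P 0 i)) =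
    (\<Sum>j\<le>n. (-1) ^ j * det (mat n n (\<lambda>(i, k). P (if k < j then k else Suc k) i)))"
proof -
  define D where "D = mat (Suc n) (Suc n) (\<lambda>(i, j). case i of 0 \<Rightarrow> 1 | Suc i' \<Rightarrow> P j i')"
  define U where "U = mat (Suc n) (Suc n) (\<lambda>(i, j). if i = j then 1 else if i = 0 then - 1 else (0 :: 'a))"
  have D: "D \<in> carrier_mat (Suc n) (Suc n)" and U: "U \<in> carrier_mat (Suc n) (Suc n)"
    by (auto simp: D_def U_def)
  have del: "mat_delete D 0 j = mat n n (\<lambda>(i, k). P (if k < j then k else Suc k) i)" for j
    by (intro eq_matI) (auto simp: mat_delete_def D_def)
  have D1: "det D = (\<Sum>j\<le>n. (-1) ^ j * det (mat n n (\<lambda>(i, k). P (if k < j then k else Suc k) i)))"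
    unfolding laplace_expansion_row[OF D zero_less_Suc] lessThan_Suc_atMost cofactor_def del
    by (intro sum.cong) (auto simp: D_def)
  have "diag_mat U = map (\<lambda>_. 1) [0..<Suc n]"
    unfolding diag_mat_def using U by (intro map_cong) (auto simp: U_def)
  then have "det U = 1"
    by (subst det_upper_triangular[OF _ U])
       (auto simp: U_def map_replicate_const simp del: upt_Suc)
  then have "det D = det (D * U)" using det_mult[OF D U] by simp
  also have "\<dots> = (\<Sum>j<Suc n. (D * U) $$ (0, j) * cofactor (D * U) 0 j)"
    by (rule laplace_expansion_row) (use D U in auto)
  also have DU: "(D * U) $$ (i, j) = (if j = 0 then D $$ (i, 0) else D $$ (i, j) - D $$ (i, 0))"
    if "i < Suc n" "j < Suc n" for i j
  proof -
    have "(D * U) $$ (i, j) = (\<Sum>k<Suc n. D $$ (i, k) * U $$ (k, j))"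
      using that D U by (simp add: scalar_prod_def lessThan_atLeast0)
    also have "\<dots> = (\<Sum>k\<in>{0, j}. D $$ (i, k) * U $$ (k, j))"
      using that by (intro sum.mono_neutral_right) (auto simp: U_def)
    also have "\<dots> = (if j = 0 then D $$ (i, 0) else D $$ (i, j) - D $$ (i, 0))"
      using that by (auto simp: U_def)
    finally show ?thesis .
  qed
  have "D $$ (0, j) = 1" if "j < Suc n" for j using that by (simp add: D_def)
  then have DU0: "(D * U) $$ (0, j) = (if j = 0 then 1 else 0)" if "j < Suc n" for j
    using that DU[of 0 j] by simp
  have "(\<Sum>j<Suc n. (D * U) $$ (0, j) * cofactor (D * U) 0 j) =
      (\<Sum>j\<in>{0}. (D * U) $$ (0, j) * cofactor (D * U) 0 j)"
    by (intro sum.mono_neutral_right) (auto simp: DU0)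
  also have "\<dots> = det (mat_delete (D * U) 0 0)"
    by (simp add: DU0 cofactor_def)
  also have "mat_delete (D * U) 0 0 = mat n n (\<lambda>(i, j). P (Suc j) i - P 0 i)"
    using D U by (intro eq_matI) (auto simp: mat_delete_def DU simp del: index_mult_mat(1), auto simp: D_def)
  finally show ?thesis using D1 by simp
qed

text \<open>
  Stokes: the boundary operator is the transpose of the coboundary.
\<close>

lemma sum_bdry:
  fixes f :: "nat set \<Rightarrow> 'a::comm_ring_1"
  assumes "finite V"
  shows "(\<Sum>s\<in>Pow V. of_int (bdry V Y s) * f s) =
    (\<Sum>t\<in>Pow V. of_int (Y t) * (\<Sum>w\<in>t. of_int (face_sign w (t - {w})) * f (t - {w})))"
proof -
  let ?g = "\<lambda>s w. of_int (face_sign w s * Y (insert w s)) * f s"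
  have "(\<Sum>s\<in>Pow V. of_int (bdry V Y s) * f s) = (\<Sum>s\<in>Pow V. \<Sum>w\<in>V. of_int (contract w Y s) * f s)"
    by (simp add: bdry_def sum_distrib_right)
  also have "\<dots> = (\<Sum>s\<in>Pow V. \<Sum>w\<in>V - s. ?g s w)"
    using assms by (intro sum.cong sum.mono_neutral_cong_right) (auto simp: contract_def)
  also have "\<dots> = (\<Sum>(s, w)\<in>(SIGMA s:Pow V. V - s). ?g s w)"
    using assms by (subst sum.Sigma) auto
  also have "\<dots> = (\<Sum>(t, w)\<in>(SIGMA t:Pow V. t). ?g (t - {w}) w)"
    by (rule sum.reindex_bij_witness[of _ "\<lambda>(t, w). (t - {w}, w)" "\<lambda>(s, w). (insert w s, w)"])
       (auto simp: insert_absorb)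
  also have "\<dots> = (\<Sum>t\<in>Pow V. \<Sum>w\<in>t. ?g (t - {w}) w)"
    using assms by (subst sum.Sigma) (auto intro: finite_subset)
  also have "\<dots> = (\<Sum>t\<in>Pow V. of_int (Y t) * (\<Sum>w\<in>t. of_int (face_sign w (t - {w})) * f (t - {w})))"
    unfolding sum_distrib_left
    by (intro sum.cong refl) (simp add: insert_absorb ac_simps)
  finally show ?thesis .
qed

lemma nth_sorted_list_remove:
  assumes "finite t" "j < card t"
  defines "xs \<equiv> sorted_list_of_set t"
  shows "sorted_list_of_set (t - {xs ! j}) = take j xs @ drop (Suc j) xs"
proof -
  have xs: "distinct xs" "sorted xs" "length xs = card t" "set xs = t" using assms by auto
  have split: "xs = take j xs @ xs ! j # drop (Suc j) xs"
    using assms(2) xs(3) by (simp add: id_take_nth_drop)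
  have "xs ! j \<notin> set (take j xs)"
    using xs(1) split by (metis distinct_append disjoint_iff list.set_intros(1))
  then have "remove1 (xs ! j) xs = take j xs @ drop (Suc j) xs"
    by (subst (2) split) (simp add: remove1_append)
  then show ?thesis using sorted_list_of_set_remove[OF assms(1)] by (simp add: xs_def)
qed

lemma face_sign_nth:
  assumes "finite t" "j < card t"
  shows "face_sign (sorted_list_of_set t ! j) (t - {sorted_list_of_set t ! j}) = (-1) ^ j"
proof -
  define xs where "xs = sorted_list_of_set t"
  have xs: "distinct xs" "sorted xs" "length xs = card t" "set xs = t"
    "sorted_wrt (<) xs" using assms by (auto simp: xs_def)
  have "{x \<in> t - {xs ! j}. x < xs ! j} = (\<lambda>i. xs ! i) ` {..<j}"
  proof
    show "{x \<in> t - {xs ! j}. x < xs ! j} \<subseteq> (\<lambda>i. xs ! i) ` {..<j}"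
    proof
      fix x assume x: "x \<in> {x \<in> t - {xs ! j}. x < xs ! j}"
      then obtain i where i: "i < length xs" "x = xs ! i" using xs(4) by (metis (no_types, lifting) Diff_iff in_set_conv_nth mem_Collect_eq)
      have "i < j"
      proof (rule ccontr)
        assume "\<not> i < j"
        then have "xs ! j \<le> xs ! i" using sorted_nth_mono[OF xs(2)] i by simp
        then show False using x i by simp
      qed
      then show "x \<in> (\<lambda>i. xs ! i) ` {..<j}" using i by auto
    qed
    show "(\<lambda>i. xs ! i) ` {..<j} \<subseteq> {x \<in> t - {xs ! j}. x < xs ! j}"
    proof
      fix x assume "x \<in> (\<lambda>i. xs ! i) ` {..<j}"
      then obtain i where i: "i < j" "x = xs ! i" by auto
      then have "x < xs ! j" using sorted_wrt_nth_less[OF xs(5)] xs(3) assms(2) by simp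
      moreover have "x \<in> t" using i xs(3,4) assms(2) nth_mem[of i xs] by simp
      ultimately show "x \<in> {x \<in> t - {xs ! j}. x < xs ! j}" by simp
    qed
  qed
  moreover have "card ((\<lambda>i. xs ! i) ` {..<j}) = j"
    using xs(1,3) assms(2) by (subst card_image) (auto simp: inj_on_def nth_eq_iff_index_eq)
  ultimately show ?thesis by (simp add: face_sign_def xs_def)
qed

lemma simplex_boundary_det:
  fixes P :: "nat \<Rightarrow> nat \<Rightarrow> 'a::comm_ring_1"
  assumes t: "card t = Suc n"
  defines "xs \<equiv> sorted_list_of_set t"
  shows "(\<Sum>w\<in>t. of_int (face_sign w (t - {w})) * points_det n P (t - {w})) =
    det (mat n n (\<lambda>(i, j). P (xs ! Suc j) i - P (xs ! 0) i))"
proof -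
  have fin: "finite t" using t card.infinite by fastforce
  have xs: "distinct xs" "length xs = Suc n" "set xs = t" using fin t by (auto simp: xs_def)
  have "(\<Sum>w\<in>t. of_int (face_sign w (t - {w})) * points_det n P (t - {w})) =
      (\<Sum>j\<le>n. of_int (face_sign (xs ! j) (t - {xs ! j})) * points_det n P (t - {xs ! j}))"
    by (rule sum.reindex_bij_betw[symmetric], rule bij_betwI')
       (use xs in \<open>auto simp: nth_eq_iff_index_eq in_set_conv_nth less_Suc_eq_le\<close>)
  also have "\<dots> = (\<Sum>j\<le>n. (-1) ^ j * det (mat n n (\<lambda>(i, k). P (xs ! (if k < j then k else Suc k)) i)))"
  proof (rule sum.cong[OF refl])
    fix j assume "j \<in> {..n}"
    then have j: "j < card t" using t by simp
    have "face_sign (xs ! j) (t - {xs ! j}) = (-1) ^ j"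
      using face_sign_nth[OF fin j] by (simp add: xs_def)
    moreover have "points_det n P (t - {xs ! j}) =
        det (mat n n (\<lambda>(i, k). P (xs ! (if k < j then k else Suc k)) i))"
      unfolding points_det_def xs_def nth_sorted_list_remove[OF fin j]
      using j fin t by (intro arg_cong[of _ _ det] cong_mat) (auto simp: nth_append min_def)
    ultimately show "of_int (face_sign (xs ! j) (t - {xs ! j})) * points_det n P (t - {xs ! j}) =
        (-1) ^ j * det (mat n n (\<lambda>(i, k). P (xs ! (if k < j then k else Suc k)) i))"
      by simp
  qed
  also have "\<dots> = det (mat n n (\<lambda>(i, j). P (xs ! Suc j) i - P (xs ! 0) i))"
    using bordered_det[of n "\<lambda>j. P (xs ! j)"] by simp
  finally show ?thesis .
qed

text \<open>
  By polarisation, the doubled Gram matrix of the edge vectors at the vertex \<open>x 0\<close> has entries in \<open>R\<close>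
  and diagonal entries in \<open>2 * R\<close>. Its determinant is \<open>2 ^ n\<close> times the square of the determinant of
  the edge vectors.
\<close>

lemma (in valuation_ring) simplex_volume_integral:
  fixes P :: "nat \<Rightarrow> nat \<Rightarrow> 'a"
  assumes two: "(2 :: 'a) \<noteq> 0"
    and dist: "\<And>i j. i \<le> n \<Longrightarrow> j \<le> n \<Longrightarrow> sq_dist n P (x i) (x j) \<in> R"
  shows "2 ^ (n div 2) * det (mat n n (\<lambda>(i, j). P (x (Suc j)) i - P (x 0) i)) \<in> R"
proof -
  note Rs = subringD[OF subring]
  define B where "B = mat n n (\<lambda>(i, j). P (x (Suc j)) i - P (x 0) i)"
  have B: "B \<in> carrier_mat n n" by (simp add: B_def)
  define G where "G = 2 \<cdot>\<^sub>m (transpose_mat B * B)"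
  have G: "G \<in> carrier_mat n n" using B by (simp add: G_def)
  have detG: "det G = 2 ^ n * (det B)\<^sup>2"
    unfolding G_def using B det_transpose[OF B] det_mult[of "transpose_mat B" n B]
    by (simp add: power2_eq_square)
  have Gij: "G $$ (i, j) = sq_dist n P (x 0) (x (Suc i)) + sq_dist n P (x 0) (x (Suc j))
      - sq_dist n P (x (Suc i)) (x (Suc j))" if "i < n" "j < n" for i j
  proof -
    have "G $$ (i, j) = (\<Sum>k<n. 2 * ((P (x (Suc i)) k - P (x 0) k) * (P (x (Suc j)) k - P (x 0) k)))"
      using that by (simp add: G_def B_def scalar_prod_def lessThan_atLeast0 sum_distrib_left)
    then show ?thesis
      by (simp add: sq_dist_def power2_eq_square algebra_simps flip: sum.distrib sum_subtractf)
  qed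
  have GR: "G $$ (i, j) \<in> R" if "i < n" "j < n" for i j
    unfolding Gij[OF that] using that by (intro Rs dist) auto
  have "(2 ^ (n div 2) * det B)\<^sup>2 \<in> R"
  proof (cases "even n")
    case True
    then have "(2 ^ (n div 2) * det B)\<^sup>2 = det G"
      by (simp add: detG power_mult_distrib flip: power_mult)
    then show ?thesis using det_mem_subring[OF subring G GR] by simp
  next
    case False
    have "\<exists>r\<in>R. det G = 2 * r"
    proof (rule det_symmetric_even_diagonal[OF subring G False two GR])
      fix i j assume ij: "i < n" "j < n"
      show "G $$ (j, i) = G $$ (i, j)"
        unfolding Gij[OF ij] Gij[OF ij(2,1)] by (simp add: sq_dist_def power2_commute)
    next
      fix i assume i: "i < n"
      have "G $$ (i, i) = 2 * sq_dist n P (x 0) (x (Suc i))"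
        unfolding Gij[OF i i] by (simp add: sq_dist_def)
      then show "\<exists>r\<in>R. G $$ (i, i) = 2 * r" using dist[of 0 "Suc i"] i by auto
    qed
    then obtain r where r: "r \<in> R" "det G = 2 * r" by blast
    have "n = Suc (2 * (n div 2))" using False by presburger
    then have "(2 :: 'a) ^ n = 2 * (2 ^ (n div 2))\<^sup>2" by (metis power_Suc power_mult mult.commute)
    then have "2 * (2 ^ (n div 2) * det B)\<^sup>2 = 2 * r"
      using r(2) detG by (simp add: power_mult_distrib)
    then have "(2 ^ (n div 2) * det B)\<^sup>2 = r" using two by simp
    then show ?thesis using r(1) by simp
  qed
  then have "2 ^ (n div 2) * det B \<in> R" by (rule mem_if_square_mem)
  then show ?thesis by (simp add: B_def)
qed

text \<open>
  The functions \<open>\<phi>\<close> and \<open>\<psi>\<close> expand the squared distance as a sum of \<open>n + 2\<close> products, which bounds the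
  rank of all matrices of squared distances.
\<close>

lemma (in valuation_ring) cycle_volume_integral:
  fixes P :: "nat \<Rightarrow> nat \<Rightarrow> 'a" and c :: schain
  assumes two: "(2 :: 'a) \<noteq> 0" and n: "n \<ge> 3" and V: "finite V"
    and c: "\<And>s. c s \<noteq> 0 \<Longrightarrow> s \<subseteq> V \<and> card s = n" "bdry V c = (\<lambda>_. 0)"
    and dist: "\<And>s x y. c s \<noteq> 0 \<Longrightarrow> x \<in> s \<Longrightarrow> y \<in> s \<Longrightarrow> sq_dist n P x y \<in> R"
  shows "2 ^ (n div 2) * (\<Sum>s\<in>Pow V. of_int (c s) * points_det n P s) \<in> R"
proof -
  define l where "l = sq_dist n P"
  have sym: "l x y = l y x" for x y by (simp add: l_def sq_dist_def power2_commute)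
  have diag: "l x x = 0" for x by (simp add: l_def sq_dist_def)
  define \<phi> where "\<phi> = (\<lambda>k x. if k < n then - 2 * P x k else if k = n then (\<Sum>i<n. (P x i)\<^sup>2) else 1)"
  define \<psi> where "\<psi> = (\<lambda>k x. if k < n then P x k else if k = n then 1 else (\<Sum>i<n. (P x i)\<^sup>2))"
  have rank: "l x y = (\<Sum>k<n + 2. \<phi> k x * \<psi> k y)" for x y
  proof -
    have "(\<Sum>k<n + 2. \<phi> k x * \<psi> k y) =
        (\<Sum>k<n. - 2 * P x k * P y k) + (\<Sum>i<n. (P x i)\<^sup>2) + (\<Sum>i<n. (P y i)\<^sup>2)"
      by (simp add: \<phi>_def \<psi>_def numeral_2_eq_2)
    also have "\<dots> = l x y"
      by (simp add: l_def sq_dist_def power2_diff sum.distrib sum_subtractf sum_negf)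
    finally show ?thesis by simp
  qed
  have finQ: "finite {(x, y). x < y \<and> x \<in> V \<and> y \<in> V \<and> l x y \<notin> R}"
    by (rule finite_subset[of _ "V \<times> V"]) (use V in auto)
  obtain Q where Q: "set Q = {(x, y). x < y \<and> x \<in> V \<and> y \<in> V \<and> l x y \<notin> R}"
    "sorted_wrt (removal_order l) Q"
    using removal_order_list[OF finQ, of l] by (elim exE conjE) (rule that)
  have "\<not> obstruction (Suc (n div 2 + 1)) V Q"
  proof
    assume "obstruction (Suc (n div 2 + 1)) V Q"
    then have "2 * Suc (n div 2 + 1) \<le> n + 2"
      using obstruction_length[OF sym diag rank Q] by blast
    then show False by presburger
  qed
  moreover have "clique_chain V Q n c"
    using c(1) dist by (auto simp: clique_chain_def clique_def Q l_def)
  moreover have "\<forall>p\<in>set Q. fst p < snd p" using Q by auto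
  moreover have "n > n div 2 + 1" using n by presburger
  ultimately obtain Y where Y: "clique_chain V Q (Suc n) Y" "bdry V Y = c"
    using cycle_bounds_if_no_obstruction[OF V subset_refl] c(2) by blast
  have "2 ^ (n div 2) * (\<Sum>s\<in>Pow V. of_int (c s) * points_det n P s) =
      (\<Sum>t\<in>Pow V. of_int (Y t) * (2 ^ (n div 2) *
        (\<Sum>w\<in>t. of_int (face_sign w (t - {w})) * points_det n P (t - {w}))))"
    unfolding Y(2)[symmetric] sum_bdry[OF V] by (simp add: sum_distrib_left mult.left_commute)
  also have "\<dots> \<in> R"
  proof (rule subring_sum[OF subring])
    fix t assume "t \<in> Pow V"
    show "of_int (Y t) * (2 ^ (n div 2) *
        (\<Sum>w\<in>t. of_int (face_sign w (t - {w})) * points_det n P (t - {w}))) \<in> R"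
    proof (cases "Y t = 0")
      case True
      then show ?thesis using ring_closed(1) by simp
    next
      case False
      then have t: "t \<subseteq> V" "card t = Suc n" "clique Q t" using Y(1) by (auto simp: clique_chain_def)
      have near': "l x y \<in> R" if "x \<in> t" "y \<in> t" "x < y" for x y
        using that t(1,3) by (auto simp: clique_def Q)
      have near: "l x y \<in> R" if "x \<in> t" "y \<in> t" for x y
        using near'[of x y] near'[of y x] that sym[of x y] diag[of x] ring_closed(1)
        by (cases x y rule: linorder_cases) simp_all
      define xs where "xs = sorted_list_of_set t"
      have "finite t" using t V finite_subset by blast
      then have "xs ! i \<in> t" if "i \<le> n" for i
        using that t(2) nth_mem[of i xs] by (simp add: xs_def)
      then have "2 ^ (n div 2) * det (mat n n (\<lambda>(i, j). P (xs ! Suc j) i - P (xs ! 0) i)) \<in> R"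
        using near by (intro simplex_volume_integral[OF two]) (auto simp: l_def)
      then have "2 ^ (n div 2) *
          (\<Sum>w\<in>t. of_int (face_sign w (t - {w})) * points_det n P (t - {w})) \<in> R"
        unfolding simplex_boundary_det[OF t(2)] xs_def .
      then show ?thesis by (rule ring_closed(3)[OF subring_of_int[OF subring]])
    qed
  qed
  finally show ?thesis .
qed

text \<open>
  Coefficients of a boundary are extracted by applying the transposition formula \<open>sum_bdry\<close> to the
  indicator function of the simplex.
\<close>

lemma bdry_cycle:
  assumes "Z \<in> cycles M k" "k > 0"
  shows "bdry {..M} (Poly_Mapping.lookup Z) = (\<lambda>_. 0)"
proof
  fix s
  let ?c = "Poly_Mapping.lookup Z"
  have Z: "t \<subseteq> {..M} \<and> card t = Suc k" if "t \<in> Poly_Mapping.keys Z" for t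
    using assms(1) that by (auto simp: cycles_def chains_def)
  show "bdry {..M} ?c s = 0"
  proof (cases "s \<subseteq> {..M}")
    case False
    then have "?c (insert w s) = 0" for w
      using Z[of "insert w s"] by (auto simp: in_keys_iff)
    then show ?thesis by (auto simp: bdry_def contract_def intro!: sum.neutral)
  next
    case True
    define f where "f = (\<lambda>u. if u = s then 1 else 0 :: int)"
    have "bdry {..M} ?c s = (\<Sum>u\<in>Pow {..M}. of_int (bdry {..M} ?c u) * f u)"
      using True by (simp add: f_def if_distrib[of "\<lambda>x. _ * x"] sum.delta cong: if_cong)
    also have "\<dots> = (\<Sum>t\<in>Pow {..M}. ?c t * (\<Sum>w\<in>t. face_sign w (t - {w}) * f (t - {w})))"
      using sum_bdry[of "{..M}" ?c f] by simp
    also have "\<dots> = (\<Sum>t\<in>Poly_Mapping.keys Z. ?c t * (\<Sum>w\<in>t. face_sign w (t - {w}) * f (t - {w})))"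
      using Z by (intro sum.mono_neutral_right) (auto simp: in_keys_iff)
    also have "\<dots> = (\<Sum>t\<in>Poly_Mapping.keys Z. ?c t * Poly_Mapping.lookup (simplex_boundary t) s)"
    proof (intro sum.cong refl arg_cong2[of _ _ _ _ "(*)"])
      fix t assume "t \<in> Poly_Mapping.keys Z"
      then have "card t = Suc k" using Z by auto
      then have large: "\<not> card t \<le> 1" using assms(2) by simp
      then have fin: "finite t" using card.infinite by fastforce
      define xs where "xs = sorted_list_of_set t"
      have xs: "distinct xs" "length xs = card t" "set xs = t" using fin by (auto simp: xs_def)
      have "(\<Sum>w\<in>t. face_sign w (t - {w}) * f (t - {w})) =
          (\<Sum>i<card t. face_sign (xs ! i) (t - {xs ! i}) * f (t - {xs ! i}))"
        by (rule sum.reindex_bij_betw[symmetric], rule bij_betwI')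
           (use xs in \<open>auto simp: nth_eq_iff_index_eq in_set_conv_nth\<close>)
      also have "\<dots> = (\<Sum>i<card t. (-1) ^ i * f (t - {xs ! i}))"
        using face_sign_nth[OF fin] by (intro sum.cong) (auto simp: xs_def)
      also have "\<dots> = Poly_Mapping.lookup (simplex_boundary t) s"
        using large by (simp add: simplex_boundary_def lookup_sum f_def xs_def eq_commute[of s])
      finally show "(\<Sum>w\<in>t. face_sign w (t - {w}) * f (t - {w})) =
        Poly_Mapping.lookup (simplex_boundary t) s" .
    qed
    also have "\<dots> = Poly_Mapping.lookup (chain_boundary Z) s"
      by (simp add: chain_boundary_def frag_extend_def lookup_sum)
    also have "\<dots> = 0" using assms(1) by (simp add: cycles_def)
    finally show ?thesis .
  qed
qed

section \<open>Evaluation of integral polynomials\<close>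

definition monom_val :: "('v \<Rightarrow> 'a::comm_ring_1) \<Rightarrow> ('v \<Rightarrow>\<^sub>0 nat) \<Rightarrow> 'a" where
  "monom_val x m = (\<Prod>e\<in>Poly_Mapping.keys m. x e ^ Poly_Mapping.lookup m e)"

definition eval_in :: "('v \<Rightarrow> 'a::comm_ring_1) \<Rightarrow> 'v int_mpoly \<Rightarrow> 'a" where
  "eval_in x p = (\<Sum>m\<in>Poly_Mapping.keys p. of_int (Poly_Mapping.lookup p m) * monom_val x m)"

lemma eval_mpoly_eq: "eval_mpoly = eval_in"
  by (simp add: eval_mpoly_def eval_in_def monom_val_def fun_eq_iff)

lemma monom_val_add: "monom_val x (m + m') = monom_val x m * monom_val x m'"
proof -
  let ?A = "Poly_Mapping.keys m \<union> Poly_Mapping.keys m'"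
  have ext: "monom_val x k = (\<Prod>e\<in>?A. x e ^ Poly_Mapping.lookup k e)"
    if "Poly_Mapping.keys k \<subseteq> ?A" for k
    unfolding monom_val_def using that
    by (intro prod.mono_neutral_left) (auto simp: in_keys_iff)
  show ?thesis
    using ext[of "m + m'"] ext[of m] ext[of m'] Poly_Mapping.keys_add[of m m']
    by (simp add: lookup_add power_add prod.distrib)
qed

lemma eval_in_frag_of: "eval_in x (frag_of m) = monom_val x m"
  by (simp add: eval_in_def)

lemma eval_in_diff: "eval_in x (p - q) = eval_in x p - eval_in x q"
proof -
  let ?A = "Poly_Mapping.keys p \<union> Poly_Mapping.keys q"
  have ext: "eval_in x r = (\<Sum>m\<in>?A. of_int (Poly_Mapping.lookup r m) * monom_val x m)"
    if "Poly_Mapping.keys r \<subseteq> ?A" for r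
    unfolding eval_in_def using that
    by (intro sum.mono_neutral_left) (auto simp: in_keys_iff)
  show ?thesis
    using ext[of "p - q"] ext[of p] ext[of q] keys_diff[of p q]
    by (simp add: lookup_minus left_diff_distrib sum_subtractf)
qed

lemma eval_in_mult: "eval_in x (p * q) = eval_in x p * eval_in x q"
proof -
  have z: "eval_in x 0 = 0" by (simp add: eval_in_def)
  have *: "eval_in x (frag_of m * q) = monom_val x m * eval_in x q" for m q
  proof (induction q rule: frag_induction[OF subset_UNIV])
    case (2 m')
    have "frag_of m * frag_of m' = frag_of (m + m')" by (simp add: mult_single)
    then show ?case by (simp add: eval_in_frag_of monom_val_add)
  next
    case (3 a b)
    then show ?case by (simp add: right_diff_distrib eval_in_diff)
  qed (simp add: z)
  show ?thesis
  proof (induction p rule: frag_induction[OF subset_UNIV])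
    case (2 m)
    then show ?case by (simp add: * eval_in_frag_of)
  next
    case (3 a b)
    then show ?case by (simp add: left_diff_distrib eval_in_diff)
  qed (simp add: z)
qed

lemma eval_in_one: "eval_in x 1 = 1"
  using eval_in_frag_of[of x 0] by (simp add: monom_val_def)

lemma comm_ring_hom_eval_in: "comm_ring_hom (eval_in x)"
proof
  show z: "eval_in x 0 = 0" by (simp add: eval_in_def)
  have neg: "eval_in x (- q) = - eval_in x q" for q
    using eval_in_diff[of x 0 q] z by simp
  show "eval_in x (p + q) = eval_in x p + eval_in x q" for p q
    using eval_in_diff[of x p "- q"] neg by simp
qed (simp_all add: eval_in_mult eval_in_one)

lemma (in comm_ring_hom) hom_eval_in: "hom (eval_in x p) = eval_in (hom \<circ> x) p"
  by (simp add: eval_in_def monom_val_def hom_distribs)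

lemma eval_in_cong:
  assumes "p \<in> int_polys E" "\<And>e. e \<in> E \<Longrightarrow> x e = y e"
  shows "eval_in x p = eval_in y p"
  unfolding eval_in_def monom_val_def
proof (intro sum.cong refl arg_cong2[of _ _ _ _ "(*)"] prod.cong)
  fix m e assume "m \<in> Poly_Mapping.keys p" "e \<in> Poly_Mapping.keys m"
  then have "e \<in> E" using assms(1) by (auto simp: int_polys_def)
  then show "x e ^ Poly_Mapping.lookup m e = y e ^ Poly_Mapping.lookup m e" using assms(2) by simp
qed

lemma subring_int_polys: "subring (int_polys E)"
  unfolding subring_def
proof (intro conjI ballI)
  show "1 \<in> int_polys E" by (auto simp: int_polys_def)
  fix p q assume pq: "p \<in> int_polys E" "q \<in> int_polys E"
  then show "p - q \<in> int_polys E" using keys_diff[of p q] by (force simp: int_polys_def)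
  show "p * q \<in> int_polys E"
    unfolding int_polys_def
  proof (intro CollectI ballI subsetI)
    fix m e assume "m \<in> Poly_Mapping.keys (p * q)" "e \<in> Poly_Mapping.keys m"
    then obtain a b where "m = a + b" "a \<in> Poly_Mapping.keys p" "b \<in> Poly_Mapping.keys q"
      using keys_mult[of p q] by blast
    then show "e \<in> E"
      using pq Poly_Mapping.keys_add[of a b] \<open>e \<in> Poly_Mapping.keys m\<close>
      unfolding int_polys_def by blast
  qed
qed

lemma (in comm_ring_hom) subring_image:
  assumes "subring S" shows "subring (hom ` S)"
  unfolding subring_def
proof (intro conjI ballI)
  show "1 \<in> hom ` S" using subringD(2)[OF assms] by (auto intro!: image_eqI[of _ _ 1])
  fix x y assume "x \<in> hom ` S" "y \<in> hom ` S"
  then obtain a b where "a \<in> S" "b \<in> S" "x = hom a" "y = hom b" by auto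
  then show "x - y \<in> hom ` S" "x * y \<in> hom ` S"
    using subringD(3,4)[OF assms] by (auto simp flip: hom_minus hom_mult)
qed

lemma (in comm_ring_hom) hom_points_det:
  "hom (points_det n P s) = points_det n (\<lambda>v i. hom (P v i)) s"
proof -
  have "map_mat hom (mat n n (\<lambda>(i, j). P (sorted_list_of_set s ! j) i)) =
      mat n n (\<lambda>(i, j). hom (P (sorted_list_of_set s ! j) i))"
    by (intro eq_matI) auto
  then show ?thesis unfolding points_det_def using hom_det by metis
qed

lemma (in comm_ring_hom) hom_sq_dist:
  "hom (sq_dist n P x y) = sq_dist n (\<lambda>v i. hom (P v i)) x y"
  by (simp add: sq_dist_def hom_distribs)

lemma comm_ring_hom_to_fract: "comm_ring_hom to_fract"
  by standard auto

section \<open>The generic polyhedron and its specialisations\<close>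

text \<open>
  The volume relative to the origin, multiplied by \<open>n!\<close> and the power of \<open>2\<close> that makes it integral.
  It makes sense over every commutative ring, which allows passing from the generic polyhedron to
  actual ones by ring homomorphisms.
\<close>

definition scaled_volume ::
    "nat \<Rightarrow> (nat set \<Rightarrow>\<^sub>0 int) \<Rightarrow> (nat \<Rightarrow> nat \<Rightarrow> 'a::comm_ring_1) \<Rightarrow> 'a" where
  "scaled_volume n Z P =
     2 ^ (n div 2) * (\<Sum>s\<in>Poly_Mapping.keys Z. of_int (Poly_Mapping.lookup Z s) * points_det n P s)"

lemma (in comm_ring_hom) hom_scaled_volume:
  "hom (scaled_volume n Z P) = scaled_volume n Z (\<lambda>v i. hom (P v i))"
  by (simp add: scaled_volume_def hom_distribs hom_points_det)

lemma scaled_volume_integral: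
  fixes P :: "nat \<Rightarrow> nat \<Rightarrow> 'a::field"
  assumes two: "(2 :: 'a) \<noteq> 0" and n: "n \<ge> 3" and Z: "Z \<in> cycles M (n - 1)"
    and val: "valuation_ring R"
    and edge: "\<And>e. e \<in> edges (supp Z) \<Longrightarrow> sq_dist n P (Min e) (Max e) \<in> R"
  shows "scaled_volume n Z P \<in> R"
proof -
  interpret valuation_ring R by (rule val)
  let ?c = "Poly_Mapping.lookup Z"
  have Zs: "s \<subseteq> {..M} \<and> card s = n" if "?c s \<noteq> 0" for s
    using Z that n by (auto simp: cycles_def chains_def in_keys_iff)
  have "2 ^ (n div 2) * (\<Sum>s\<in>Pow {..M}. of_int (?c s) * points_det n P s) \<in> R"
  proof (rule cycle_volume_integral[OF two n _ Zs])
    show "bdry {..M} ?c = (\<lambda>_. 0)" using bdry_cycle[OF Z] n by simp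
    fix s x y assume s: "?c s \<noteq> 0" and xy: "x \<in> s" "y \<in> s"
    have *: "sq_dist n P a b \<in> R" if ab: "a \<in> s" "b \<in> s" "a < b" for a b
    proof -
      have "{a, b} \<in> edges (supp Z)"
        using s ab by (auto simp: edges_def supp_def in_keys_iff intro!: bexI[of _ s])
      then show ?thesis using edge[of "{a, b}"] ab by simp
    qed
    have "sq_dist n P x y = sq_dist n P y x" by (simp add: sq_dist_def power2_commute)
    moreover have "sq_dist n P x x = 0" by (simp add: sq_dist_def)
    ultimately show "sq_dist n P x y \<in> R"
      using *[of x y] *[of y x] xy ring_closed(1) by (cases x y rule: linorder_cases) auto
  qed auto
  also have "(\<Sum>s\<in>Pow {..M}. of_int (?c s) * points_det n P s) =
      (\<Sum>s\<in>Poly_Mapping.keys Z. of_int (?c s) * points_det n P s)"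
    using Zs by (intro sum.mono_neutral_right) (auto simp: in_keys_iff)
  finally show ?thesis by (simp add: scaled_volume_def)
qed

text \<open>
  The generic polyhedron: its coordinates are distinct variables.
\<close>

definition coordinate :: "nat \<Rightarrow> nat \<Rightarrow> nat int_mpoly" where
  "coordinate v i = frag_of (Poly_Mapping.single (prod_encode (v, i)) 1)"

lemma eval_in_coordinate: "eval_in x (coordinate v i) = x (prod_encode (v, i))"
  by (simp add: coordinate_def eval_in_frag_of monom_val_def)

text \<open>
  Integrality is stated for the square of the volume, so that only even powers occur in the relation.
\<close>

lemma universal_volume_relation:
  assumes n: "n \<ge> 3" and Z: "Z \<in> cycles M (n - 1)"
  shows "\<exists>N\<ge>1. \<exists>b :: nat \<Rightarrow> nat set int_mpoly. (\<forall>i. b i \<in> int_polys (edges (supp Z))) \<and>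
    (\<forall>P :: nat \<Rightarrow> nat \<Rightarrow> real. scaled_volume n Z P ^ (2 * N) +
      (\<Sum>i=1..N. eval_in (\<lambda>e. sq_dist n P (Min e) (Max e)) (b i) *
        scaled_volume n Z P ^ (2 * N - 2 * i)) = 0)"
proof -
  define E where "E = edges (supp Z)"
  define l where "l = (\<lambda>e. sq_dist n coordinate (Min e) (Max e))"
  define w where "w = scaled_volume n Z coordinate"
  interpret fr: comm_ring_hom "to_fract :: nat int_mpoly \<Rightarrow> nat int_mpoly fract"
    by (rule comm_ring_hom_to_fract)
  interpret ev: comm_ring_hom "eval_in (to_fract \<circ> l) :: nat set int_mpoly \<Rightarrow> _"
    by (rule comm_ring_hom_eval_in)
  define B where "B = eval_in (to_fract \<circ> l) ` int_polys E"
  have B: "subring B" unfolding B_def by (rule ev.subring_image[OF subring_int_polys])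
  have lB: "to_fract (l e) \<in> B" if "e \<in> E" for e
  proof -
    have "eval_in (to_fract \<circ> l) (frag_of (Poly_Mapping.single e 1)) = to_fract (l e)"
      by (simp add: eval_in_frag_of monom_val_def)
    moreover have "frag_of (Poly_Mapping.single e 1) \<in> int_polys E"
      using that by (simp add: int_polys_def)
    ultimately show ?thesis unfolding B_def by (metis imageI)
  qed
  have two: "(2 :: nat int_mpoly fract) \<noteq> 0"
  proof -
    have "to_fract (2 :: nat int_mpoly) \<noteq> 0" by simp
    then show ?thesis by (metis fr.hom_add fr.hom_one one_add_one)
  qed
  have "(to_fract w)\<^sup>2 \<in> R" if "valuation_ring R" "B \<subseteq> R" for R
  proof -
    interpret valuation_ring R by (rule that(1))
    have "to_fract w \<in> R"
      unfolding w_def fr.hom_scaled_volume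
    proof (rule scaled_volume_integral[OF two n Z that(1)])
      fix e assume "e \<in> edges (supp Z)"
      then show "sq_dist n (\<lambda>v i. to_fract (coordinate v i)) (Min e) (Max e) \<in> R"
        using lB that(2) unfolding l_def fr.hom_sq_dist E_def by blast
    qed
    then show ?thesis using ring_closed(3) by (simp add: power2_eq_square)
  qed
  from integral_if_in_valuation_rings[OF B this]
  obtain N b where N: "N \<ge> 1" and b: "\<And>i. b i \<in> B"
    and rel: "((to_fract w)\<^sup>2) ^ N + (\<Sum>i=1..N. b i * ((to_fract w)\<^sup>2) ^ (N - i)) = 0"
    by blast
  have "\<exists>\<beta>. \<beta> \<in> int_polys E \<and> b i = eval_in (to_fract \<circ> l) \<beta>" for i
    using b[of i] unfolding B_def by blast
  then obtain \<beta> where \<beta>: "\<And>i. \<beta> i \<in> int_polys E" "\<And>i. b i = eval_in (to_fract \<circ> l) (\<beta> i)"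
    by metis
  have "to_fract ((w\<^sup>2) ^ N + (\<Sum>i=1..N. eval_in l (\<beta> i) * (w\<^sup>2) ^ (N - i))) = 0"
    unfolding fr.hom_add fr.hom_sum fr.hom_mult fr.hom_power fr.hom_eval_in
    using rel by (simp add: \<beta>(2))
  then have rel': "(w\<^sup>2) ^ N + (\<Sum>i=1..N. eval_in l (\<beta> i) * (w\<^sup>2) ^ (N - i)) = 0" by (simp only: to_fract_eq_0_iff)
  show ?thesis
  proof (intro exI[of _ N] conjI N exI[of _ \<beta>] allI)
    show "\<beta> i \<in> int_polys (edges (supp Z))" for i using \<beta>(1) by (simp add: E_def)
    fix P :: "nat \<Rightarrow> nat \<Rightarrow> real"
    define \<xi> where "\<xi> = (\<lambda>k. case prod_decode k of (v, i) \<Rightarrow> P v i)"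
    interpret sp: comm_ring_hom "eval_in \<xi>" by (rule comm_ring_hom_eval_in)
    have coord: "eval_in \<xi> (coordinate v i) = P v i" for v i
      by (simp add: eval_in_coordinate \<xi>_def)
    have sw: "eval_in \<xi> w = scaled_volume n Z P"
      unfolding w_def by (simp add: sp.hom_scaled_volume coord)
    have sl: "eval_in \<xi> \<circ> l = (\<lambda>e. sq_dist n P (Min e) (Max e))"
      by (simp add: l_def fun_eq_iff sp.hom_sq_dist coord)
    have "eval_in \<xi> ((w\<^sup>2) ^ N + (\<Sum>i=1..N. eval_in l (\<beta> i) * (w\<^sup>2) ^ (N - i))) = 0"
      unfolding rel' by simp
    then show "scaled_volume n Z P ^ (2 * N) +
        (\<Sum>i=1..N. eval_in (\<lambda>e. sq_dist n P (Min e) (Max e)) (\<beta> i) *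
          scaled_volume n Z P ^ (2 * N - 2 * i)) = 0"
      by (simp add: sp.hom_add sp.hom_sum sp.hom_mult sp.hom_power sp.hom_eval_in sw sl
          diff_mult_distrib2 flip: power_mult)
  qed
qed

lemma polyhedron_vertex:
  assumes "polyhedron n Z P" "{v} \<in> supp Z"
  shows "P (vertex_point v) \<in> carrier_vec n"
proof -
  have "{w. vertex_point v w \<noteq> 0} = {v}" by (auto simp: vertex_point_def)
  then have "vertex_point v \<in> realization (supp Z)"
    using assms(2) by (simp add: realization_def) (simp add: vertex_point_def)
  then show ?thesis using assms(1) by (simp add: polyhedron_def)
qed

text \<open>
  An arbitrary base point \<open>q\<close> is absorbed by translating the polyhedron, which leaves its edge lengths
  unchanged.
\<close>

lemma scaled_volume_polyhedron:
  assumes Z: "Z \<in> cycles M (n - 1)" "n \<ge> 3" and P: "polyhedron n Z P" and q: "q \<in> carrier_vec n"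
  shows "2 ^ (n div 2) * fact n * gen_volume n Z q P =
    scaled_volume n Z (\<lambda>v i. P (vertex_point v) $ i - q $ i)"
proof -
  have "fact n * simplex_volume n q (map (\<lambda>v. P (vertex_point v)) (sorted_list_of_set s)) =
      points_det n (\<lambda>v i. P (vertex_point v) $ i - q $ i) s" if s: "s \<in> Poly_Mapping.keys Z" for s
  proof -
    have card: "card s = n" using Z s by (auto simp: cycles_def chains_def)
    then have fin: "finite s" using Z(2) card.infinite by fastforce
    have nth: "sorted_list_of_set s ! j \<in> s" if "j < n" for j
      using nth_mem[of j "sorted_list_of_set s"] that card fin by simp
    have "{v} \<in> supp Z" if "v \<in> s" for v using s that by (auto simp: supp_def)
    then have car: "P (vertex_point (sorted_list_of_set s ! j)) \<in> carrier_vec n" if "j < n" for j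
      using polyhedron_vertex[OF P] nth[OF that] by blast
    have "mat_of_cols n (map (\<lambda>p. p - q) (map (\<lambda>v. P (vertex_point v)) (sorted_list_of_set s))) =
        mat n n (\<lambda>(i, j). P (vertex_point (sorted_list_of_set s ! j)) $ i - q $ i)"
      using card q car by (intro eq_matI) (auto simp: mat_of_cols_def)
    then show ?thesis by (simp add: simplex_volume_def points_det_def)
  qed
  then show ?thesis
    by (simp add: gen_volume_def scaled_volume_def sum_distrib_left mult.assoc mult.left_commute[of "fact n"])
qed

lemma edge_length_sq_polyhedron:
  assumes P: "polyhedron n Z P" and q: "q \<in> carrier_vec n" and e: "e \<in> edges (supp Z)"
  shows "edge_length_sq P e = sq_dist n (\<lambda>v i. P (vertex_point v) $ i - q $ i) (Min e) (Max e)"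
proof -
  have "card e = 2" using e by (simp add: edges_def)
  then have "finite e" "e \<noteq> {}" using card.infinite by fastforce+
  then have "{Min e} \<in> supp Z" "{Max e} \<in> supp Z"
    using e by (auto simp: edges_def supp_def intro: Min_in Max_in subsetD)
  then have "P (vertex_point (Min e)) \<in> carrier_vec n" "P (vertex_point (Max e)) \<in> carrier_vec n"
    using polyhedron_vertex[OF P] by auto
  then show ?thesis
    by (simp add: edge_length_sq_def euclidean_norm_def sq_dist_def scalar_prod_def
        power2_eq_square lessThan_atLeast0 sum_nonneg)
qed

theorem theorem1p7:
  fixes n M :: nat and Z :: "nat set \<Rightarrow>\<^sub>0 int"
  assumes "n \<ge> 3" and "Z \<in> cycles M (n - 1)"
  shows "\<exists>N \<ge> 1. \<exists>b :: nat \<Rightarrow> nat set int_mpoly.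
           (\<forall>i \<in> {1..N}. b i \<in> int_polys (edges (supp Z))) \<and>
           (\<forall>P q W. polyhedron n Z P \<longrightarrow> q \<in> carrier_vec n \<longrightarrow>
              W = 2 ^ (n div 2) * fact n * gen_volume n Z q P \<longrightarrow>
              W ^ (2 * N) +
                (\<Sum>i = 1..N. eval_mpoly (edge_length_sq P) (b i) * W ^ (2 * N - 2 * i)) = 0)"
proof -
  obtain N b where N: "N \<ge> 1" and b: "\<And>i. b i \<in> int_polys (edges (supp Z))"
    and rel: "\<And>P :: nat \<Rightarrow> nat \<Rightarrow> real. scaled_volume n Z P ^ (2 * N) +
      (\<Sum>i=1..N. eval_in (\<lambda>e. sq_dist n P (Min e) (Max e)) (b i) *
        scaled_volume n Z P ^ (2 * N - 2 * i)) = 0"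
    using universal_volume_relation[OF assms] by blast
  show ?thesis
  proof (intro exI[of _ N] conjI N exI[of _ b] ballI allI impI)
    fix P q W
    assume P: "polyhedron n Z P" and q: "q \<in> carrier_vec n"
      and W: "W = 2 ^ (n div 2) * fact n * gen_volume n Z q P"
    define P' where "P' = (\<lambda>v i. P (vertex_point v) $ i - q $ i)"
    have "W = scaled_volume n Z P'"
      unfolding W P'_def by (rule scaled_volume_polyhedron[OF assms(2,1) P q])
    moreover have "eval_mpoly (edge_length_sq P) (b i) =
        eval_in (\<lambda>e. sq_dist n P' (Min e) (Max e)) (b i)" for i
      unfolding eval_mpoly_eq P'_def
      by (rule eval_in_cong[OF b]) (rule edge_length_sq_polyhedron[OF P q])
    ultimately show "W ^ (2 * N) +
        (\<Sum>i = 1..N. eval_mpoly (edge_length_sq P) (b i) * W ^ (2 * N - 2 * i)) = 0"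
      using rel[of P'] by simp
  qed (use b in auto)
qed

end
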